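(* Let $q$ be a distribution on $(0,1)$ and let the initial data $u_0,u_1$ be distributions on $(0,1)$; fix $T>0$. Then the initial/boundary problem $$\partial_t^2u(t,x)-\partial_x^2u(t,x)+q(x)u(t,x)=0,\ (t,x)\in[0,T]\times(0,1),\quad u(0,x)=u_0(x),\ \partial_tu(0,x)=u_1(x),\quad u(t,0)=0=u(t,1),$$ has a very weak solution.
   Context: Nets are indexed by $\varepsilon\in(0,1]$. A net of functions $(u_\varepsilon)$ is $L^2$-moderate if there exist $N\in\mathbb{N}_0$ and $C>0$ with $\|u_\varepsilon\|_{L^2}\le C\varepsilon^{-N}$ (for nets $u_\varepsilon(t,x)$ depending on $t\in[0,T]$, $\|u_\varepsilon(t,\cdot)\|_{L^2}\le C\varepsilon^{-N}$ uniformly in $t$). A net $(q_\varepsilon)$ is $L^\infty$-moderate if there exist $N\in\mathbb{N}_0$, $C>0$ with $\|q_\varepsilon\|_{L^\infty}\le C\varepsilon^{-N}$. A regularisation of a distribution is a net of smooth functions on $(0,1)$ approximating it (e.g. obtained by convolution with a mollifier $\psi_\varepsilon(x)=\varepsilon^{-1}\psi(x/\varepsilon)$, $\psi\in C_0^\infty(\mathbb{R})$, $\int\psi=1$). A net $(u_\varepsilon)_{\varepsilon>0}$ is a very weak solution of the problem if there exist an $L^\infty$-moderate regularisation $(q_\varepsilon)$ of $q$ and $L^2$-moderate regularisations $(u_{0,\varepsilon})$, $(u_{1,\varepsilon})$ of $u_0,u_1$ such that for each $\varepsilon$, $u_\varepsilon$ solves $\partial_t^2u_\varepsilon-\partial_x^2u_\varepsilon+q_\varepsilon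 u_\varepsilon=0$ on $[0,T]\times(0,1)$ with $u_\varepsilon(0,\cdot)=u_{0,\varepsilon}$, $\partial_tu_\varepsilon(0,\cdot)=u_{1,\varepsilon}$, $u_\varepsilon(t,0)=0=u_\varepsilon(t,1)$, and both $(u_\varepsilon)$ and $(\partial_tu_\varepsilon)$ are $L^2$-moderate. *)

theory Defs
  imports "HOL-Analysis.Analysis"
begin

definition smooth_on :: "real set \<Rightarrow> (real \<Rightarrow> real) \<Rightarrow> bool" where
  "smooth_on S f \<longleftrightarrow> (\<forall>k::nat. \<forall>x\<in>S. ((deriv ^^ k) f) differentiable (at x))"

definition test_fun :: "(real \<Rightarrow> real) \<Rightarrow> bool" where
  "test_fun \<phi> \<longleftrightarrow> smooth_on UNIV \<phi> \<and>
     (\<exists>a b. 0 < a \<and> b < 1 \<and> (\<forall>x. x \<notin> {a..b} \<longrightarrow> \<phi> x = 0))"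

definition distribution01 :: "((real \<Rightarrow> real) \<Rightarrow> real) \<Rightarrow> bool" where
  "distribution01 D \<longleftrightarrow>
     (\<forall>\<phi> \<psi>. test_fun \<phi> \<longrightarrow> test_fun \<psi> \<longrightarrow> D (\<lambda>x. \<phi> x + \<psi> x) = D \<phi> + D \<psi>) \<and>
     (\<forall>\<phi> c. test_fun \<phi> \<longrightarrow> D (\<lambda>x. c * \<phi> x) = c * D \<phi>) \<and>
     (\<forall>a b. 0 < a \<longrightarrow> b < 1 \<longrightarrow> (\<exists>C m. \<forall>\<phi>. test_fun \<phi> \<longrightarrow>
         (\<forall>x. x \<notin> {a..b} \<longrightarrow> \<phi> x = 0) \<longrightarrow>
         \<bar>D \<phi>\<bar> \<le> C * (\<Sum>k\<le>(m::nat). (SUP x. \<bar>(deriv ^^ k) \<phi> x\<bar>))))"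

definition regularisation :: "(real \<Rightarrow> real \<Rightarrow> real) \<Rightarrow> ((real \<Rightarrow> real) \<Rightarrow> real) \<Rightarrow> bool" where
  "regularisation v D \<longleftrightarrow>
     (\<forall>\<epsilon>\<in>{0<..1}. smooth_on {0<..<1} (v \<epsilon>)) \<and>
     (\<forall>\<phi>. test_fun \<phi> \<longrightarrow>
        ((\<lambda>\<epsilon>. integral {0..1} (\<lambda>x. v \<epsilon> x * \<phi> x)) \<longlongrightarrow> D \<phi>) (at_right 0))"

definition L2_moderate :: "(real \<Rightarrow> real \<Rightarrow> real) \<Rightarrow> bool" where
  "L2_moderate v \<longleftrightarrow> (\<exists>N::nat. \<exists>C>0. \<forall>\<epsilon>\<in>{0<..1}.
     (\<lambda>x. (v \<epsilon> x)\<^sup>2) integrable_on {0..1} \<and>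
     sqrt (integral {0..1} (\<lambda>x. (v \<epsilon> x)\<^sup>2)) \<le> C * \<epsilon> powr (- real N))"

definition L2_moderate_t :: "real \<Rightarrow> (real \<Rightarrow> real \<Rightarrow> real \<Rightarrow> real) \<Rightarrow> bool" where
  "L2_moderate_t T w \<longleftrightarrow> (\<exists>N::nat. \<exists>C>0. \<forall>\<epsilon>\<in>{0<..1}. \<forall>t\<in>{0..T}.
     (\<lambda>x. (w \<epsilon> t x)\<^sup>2) integrable_on {0..1} \<and>
     sqrt (integral {0..1} (\<lambda>x. (w \<epsilon> t x)\<^sup>2)) \<le> C * \<epsilon> powr (- real N))"

text \<open>L^infinity((0,1))-moderate nets (for smooth q_eps the ess sup is the sup over (0,1)).\<close>
definition Linf_moderate :: "(real \<Rightarrow> real \<Rightarrow> real) \<Rightarrow> bool" where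
  "Linf_moderate v \<longleftrightarrow> (\<exists>N::nat. \<exists>C>0. \<forall>\<epsilon>\<in>{0<..1}. \<forall>x\<in>{0<..<1}.
     \<bar>v \<epsilon> x\<bar> \<le> C * \<epsilon> powr (- real N))"

definition wave_solution ::
  "real \<Rightarrow> (real \<Rightarrow> real) \<Rightarrow> (real \<Rightarrow> real) \<Rightarrow> (real \<Rightarrow> real) \<Rightarrow>
   (real \<Rightarrow> real \<Rightarrow> real) \<Rightarrow> (real \<Rightarrow> real \<Rightarrow> real) \<Rightarrow> bool" where
  "wave_solution T q f0 f1 u ut \<longleftrightarrow>
     continuous_on ({0..T} \<times> {0..1}) (\<lambda>(t,x). u t x) \<and>
     (\<exists>utt ux uxx.
        continuous_on ({0..T} \<times> {0<..<1}) (\<lambda>(t,x). ut t x) \<and>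
        continuous_on ({0..T} \<times> {0<..<1}) (\<lambda>(t,x). utt t x) \<and>
        continuous_on ({0..T} \<times> {0<..<1}) (\<lambda>(t,x). ux t x) \<and>
        continuous_on ({0..T} \<times> {0<..<1}) (\<lambda>(t,x). uxx t x) \<and>
        (\<forall>t\<in>{0..T}. \<forall>x\<in>{0<..<1}.
           ((\<lambda>s. u s x) has_real_derivative ut t x) (at t within {0..T}) \<and>
           ((\<lambda>s. ut s x) has_real_derivative utt t x) (at t within {0..T}) \<and>
           ((\<lambda>y. u t y) has_real_derivative ux t x) (at x) \<and>
           ((\<lambda>y. ux t y) has_real_derivative uxx t x) (at x) \<and>
           utt t x - uxx t x + q x * u t x = 0)) \<and>
     (\<forall>x\<in>{0<..<1}. u 0 x = f0 x \<and> ut 0 x = f1 x) \<and>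
     (\<forall>t\<in>{0..T}. u t 0 = 0 \<and> u t 1 = 0)"

definition very_weak_solution ::
  "real \<Rightarrow> ((real \<Rightarrow> real) \<Rightarrow> real) \<Rightarrow> ((real \<Rightarrow> real) \<Rightarrow> real) \<Rightarrow> ((real \<Rightarrow> real) \<Rightarrow> real) \<Rightarrow>
   (real \<Rightarrow> real \<Rightarrow> real \<Rightarrow> real) \<Rightarrow> bool" where
  "very_weak_solution T q u0 u1 u \<longleftrightarrow>
     (\<exists>q\<^sub>\<epsilon> u0\<^sub>\<epsilon> u1\<^sub>\<epsilon> ut.
        regularisation q\<^sub>\<epsilon> q \<and> Linf_moderate q\<^sub>\<epsilon> \<and>
        regularisation u0\<^sub>\<epsilon> u0 \<and> L2_moderate u0\<^sub>\<epsilon> \<and>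
        regularisation u1\<^sub>\<epsilon> u1 \<and> L2_moderate u1\<^sub>\<epsilon> \<and>
        (\<forall>\<epsilon>\<in>{0<..1}. wave_solution T (q\<^sub>\<epsilon> \<epsilon>) (u0\<^sub>\<epsilon> \<epsilon>) (u1\<^sub>\<epsilon> \<epsilon>) (u \<epsilon>) (ut \<epsilon>)) \<and>
        L2_moderate_t T u \<and> L2_moderate_t T ut)"

end

theory Submission
  imports Defs
begin

text \<open>A distribution on (0,1) is the weak limit of a sequence of trigonometric polynomials: mollify it,
  and correct the resulting continuous functions by Weierstrass approximation. Choosing
  \<open>P (cos (pi * x))\<close> for the potential and \<open>sin (pi * x) * P (cos (pi * x))\<close> for the
  initial data, the Dirichlet problem becomes the Cauchy problem on the whole line with data odd about 0
  and 1, which Duhamel's formula and a contraction argument solve classically. No energy estimate is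
  needed: moderateness does not prescribe the speed of the regularisation, so letting the index of the
  sequence tend to infinity slowly enough as \<open>\<epsilon> \<rightarrow> 0\<close> bounds everything by
  \<open>C / \<epsilon>\<close>.\<close>

section \<open>Smooth functions of one real variable\<close>

text \<open>Reflection turns the Dirichlet problem into a Cauchy problem only if the even potential
  and the odd data stay smooth across the endpoints. A trigonometric polynomial is one formula on
  the whole line, so its symmetry, its smoothness and the boundedness of each derivative need no
  gluing. Density comes from Weierstrass after the substitution \<open>y = cos (pi * x)\<close>; for
  the data the factor \<open>sin (pi * x)\<close> has to be divided out first, and for this the
  continuous approximants vanish near 0 and 1. The obstacle in the approximation is the order of
  choices: an approximant is fixed before the test function is known, whereas constant and order in
  the continuity estimate of a distribution depend on the support of the test function. So all
  errors are explicit in these data, and the approximant at scale \<open>r\<close> serves every test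
  function that is admissible at scale \<open>r\<close>; each test function is admissible once
  \<open>r\<close> is small. The fixed point is at first only continuous. Duhamel's formula gains
  one derivative, and spending this gain on the right-hand side makes the solution twice
  differentiable.\<close>

lemma higher_deriv_unique:
  assumes "\<And>k x. (F k has_real_derivative F (Suc k) x) (at x)"
  shows "(deriv ^^ k) (F 0) = F k"
proof (induction k)
  case (Suc k)
  then show ?case
    using assms DERIV_imp_deriv by fastforce
qed simp

lemma smooth_on_UNIV_I:
  assumes "\<And>k x. (F k has_real_derivative F (Suc k) x) (at x)"
  shows "smooth_on UNIV (F 0)"
  unfolding smooth_on_def higher_deriv_unique[of F, OF assms]
  using assms real_differentiable_def by blast

text \<open>Coinduction replaces closed formulas for the \<open>k\<close>-th derivative: a class
  closed under differentiation consists of smooth functions. The second conclusion keeps the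
  iterates in the class, which later yields bounds for all derivatives at once.\<close>

lemma smooth_on_UNIV_coinduct:
  assumes "f \<in> X" and step: "\<And>g. g \<in> X \<Longrightarrow> \<exists>g'\<in>X. \<forall>x. (g has_real_derivative g' x) (at x)"
  shows "smooth_on UNIV f" and "(deriv ^^ k) f \<in> X"
proof -
  have *: "(deriv ^^ k) f \<in> X \<and> (\<forall>x. (deriv ^^ k) f differentiable (at x))" for k
  proof (induction k)
    case 0
    then show ?case using assms real_differentiable_def by fastforce
  next
    case (Suc k)
    then obtain g' where g': "g' \<in> X" "\<forall>x. ((deriv ^^ k) f has_real_derivative g' x) (at x)"
      using step by blast
    then have "(deriv ^^ Suc k) f = g'"
      using DERIV_imp_deriv by fastforce
    then show ?case using g' step real_differentiable_def by metis
  qed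
  then show "smooth_on UNIV f" by (auto simp: smooth_on_def)
  show "(deriv ^^ k) f \<in> X" using * by blast
qed

lemma smooth_on_DERIV:
  assumes "smooth_on S f" "x \<in> S"
  shows "((deriv ^^ k) f has_real_derivative (deriv ^^ Suc k) f x) (at x)"
  using assms by (simp add: smooth_on_def DERIV_deriv_iff_real_differentiable)

lemma smooth_on_subset: "smooth_on S f \<Longrightarrow> R \<subseteq> S \<Longrightarrow> smooth_on R f"
  by (auto simp: smooth_on_def)

lemma smooth_on_deriv: "smooth_on S f \<Longrightarrow> smooth_on S (deriv f)"
  unfolding smooth_on_def by (metis funpow_Suc_right o_apply)

lemma smooth_on_continuous_higher_deriv:
  "smooth_on UNIV f \<Longrightarrow> continuous_on A ((deriv ^^ k) f)"
  by (meson smooth_on_DERIV UNIV_I DERIV_isCont continuous_at_imp_continuous_on)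

text \<open>Products alone are not closed under differentiation, but by the product rule their
  finite sums are; this bypasses the general Leibniz formula.\<close>

inductive_set product_sums :: "(real \<Rightarrow> real) set" where
  prod: "smooth_on UNIV f \<Longrightarrow> smooth_on UNIV g \<Longrightarrow> (\<lambda>x. f x * g x) \<in> product_sums"
| add: "f \<in> product_sums \<Longrightarrow> g \<in> product_sums \<Longrightarrow> (\<lambda>x. f x + g x) \<in> product_sums"

lemma smooth_on_mult:
  assumes "smooth_on UNIV f" "smooth_on UNIV g"
  shows "smooth_on UNIV (\<lambda>x. f x * g x)"
proof (rule smooth_on_UNIV_coinduct(1))
  show "(\<lambda>x. f x * g x) \<in> product_sums" using assms by (rule product_sums.prod)
next
  fix h assume "h \<in> product_sums"
  then show "\<exists>h'\<in>product_sums. \<forall>x. (h has_real_derivative h' x) (at x)"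
  proof induction
    case (prod f g)
    have "(\<lambda>x. f x * deriv g x + deriv f x * g x) \<in> product_sums"
      using prod by (intro product_sums.intros smooth_on_deriv)
    moreover have "((\<lambda>x. f x * g x) has_real_derivative f x * deriv g x + deriv f x * g x) (at x)" for x
      using smooth_on_DERIV[OF prod(1), of x 0] smooth_on_DERIV[OF prod(2), of x 0]
      by (auto intro!: derivative_eq_intros)
    ultimately show ?case
      by (intro bexI[of _ "\<lambda>x. f x * deriv g x + deriv f x * g x"]) auto
  next
    case (add f g)
    then obtain f' g' where "f' \<in> product_sums" "\<forall>x. (f has_real_derivative f' x) (at x)"
      "g' \<in> product_sums" "\<forall>x. (g has_real_derivative g' x) (at x)" by blast
    then show ?case
      by (intro bexI[of _ "\<lambda>x. f' x + g' x"]) (auto intro!: derivative_intros product_sums.add)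
  qed
qed

text \<open>The one form \<open>a + c * x\<close> covers translations and reflections. Terms such as
  \<open>r + 1 * x\<close> or \<open>- y + 1 * x\<close> below are written so as to match
  it.\<close>

lemma smooth_on_affine:
  assumes "smooth_on UNIV f"
  shows "smooth_on UNIV (\<lambda>x. f (a + c * x))"
    and "(deriv ^^ k) (\<lambda>x. f (a + c * x)) = (\<lambda>x. c ^ k * (deriv ^^ k) f (a + c * x))"
proof -
  define F where "F k x = c ^ k * (deriv ^^ k) f (a + c * x)" for k x
  have F: "(F k has_real_derivative F (Suc k) x) (at x)" for k x
    unfolding F_def
    by (rule derivative_eq_intros DERIV_chain2[OF smooth_on_DERIV[OF assms]] | simp)+
  have F0: "F 0 = (\<lambda>x. f (a + c * x))" by (simp add: F_def fun_eq_iff)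
  show "smooth_on UNIV (\<lambda>x. f (a + c * x))"
    using smooth_on_UNIV_I[of F, OF F] F0 by simp
  show "(deriv ^^ k) (\<lambda>x. f (a + c * x)) = (\<lambda>x. c ^ k * (deriv ^^ k) f (a + c * x))"
    using higher_deriv_unique[of F, OF F] F0 by (simp add: F_def fun_eq_iff)
qed

lemma smooth_on_add_scaled:
  assumes "smooth_on UNIV f" "smooth_on UNIV g"
  shows "smooth_on UNIV (\<lambda>x. f x + c * g x)"
    and "(deriv ^^ k) (\<lambda>x. f x + c * g x) = (\<lambda>x. (deriv ^^ k) f x + c * (deriv ^^ k) g x)"
proof -
  define F where "F k x = (deriv ^^ k) f x + c * (deriv ^^ k) g x" for k x
  have F: "(F k has_real_derivative F (Suc k) x) (at x)" for k x
    unfolding F_def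
    by (rule derivative_eq_intros smooth_on_DERIV assms | simp)+
  have F0: "F 0 = (\<lambda>x. f x + c * g x)" by (simp add: F_def fun_eq_iff)
  show "smooth_on UNIV (\<lambda>x. f x + c * g x)"
    using smooth_on_UNIV_I[of F, OF F] F0 by simp
  show "(deriv ^^ k) (\<lambda>x. f x + c * g x) = (\<lambda>x. (deriv ^^ k) f x + c * (deriv ^^ k) g x)"
    using higher_deriv_unique[of F, OF F] F0 by (simp add: F_def fun_eq_iff)
qed

lemma higher_deriv_zero: "(deriv ^^ k) (\<lambda>x. 0) = (\<lambda>x. 0::real)"
  using higher_deriv_unique[of "\<lambda>k x. 0::real"] by simp

lemma smooth_on_zero: "smooth_on UNIV (\<lambda>x. 0)"
  using smooth_on_UNIV_I[of "\<lambda>k x. 0"] by simp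

lemma smooth_on_sum_scaled:
  fixes n :: nat
  assumes "\<And>i. i < n \<Longrightarrow> smooth_on UNIV (f i)"
  shows "smooth_on UNIV (\<lambda>x. \<Sum>i<n. c i * f i x)"
    and "(deriv ^^ k) (\<lambda>x. \<Sum>i<n. c i * f i x) = (\<lambda>x. \<Sum>i<n. c i * (deriv ^^ k) (f i) x)"
proof -
  have "smooth_on UNIV (\<lambda>x. \<Sum>i<n. c i * f i x) \<and>
    (deriv ^^ k) (\<lambda>x. \<Sum>i<n. c i * f i x) = (\<lambda>x. \<Sum>i<n. c i * (deriv ^^ k) (f i) x)"
    using assms
  proof (induction n)
    case 0
    then show ?case by (simp add: smooth_on_zero higher_deriv_zero)
  next
    case (Suc n)
    then show ?case by (simp add: smooth_on_add_scaled)
  qed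
  then show "smooth_on UNIV (\<lambda>x. \<Sum>i<n. c i * f i x)"
    and "(deriv ^^ k) (\<lambda>x. \<Sum>i<n. c i * f i x) = (\<lambda>x. \<Sum>i<n. c i * (deriv ^^ k) (f i) x)"
    by auto
qed

section \<open>Bump functions built from \<open>exp (- 1 / x)\<close>\<close>

definition exp_cutoff :: "(real \<Rightarrow> real) \<Rightarrow> real \<Rightarrow> real" where
  "exp_cutoff p x = (if x \<le> 0 then 0 else p (1 / x) * exp (- (1 / x)))"

lemma real_polynomial_function_exp_tendsto_0:
  fixes p :: "real \<Rightarrow> real"
  assumes "real_polynomial_function p"
  shows "((\<lambda>s. p s * exp (- s)) \<longlongrightarrow> 0) at_top"
proof -
  obtain a n where p: "p = (\<lambda>x. \<Sum>i\<le>n. a i * x ^ i)"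
    using assms by (auto simp: real_polynomial_function_iff_sum)
  have "((\<lambda>s::real. \<Sum>i\<le>n. a i * (s ^ i / exp s)) \<longlongrightarrow> (\<Sum>i\<le>n. a i * 0)) at_top"
    by (intro tendsto_intros tendsto_power_div_exp_0)
  then show ?thesis
    by (simp add: p sum_divide_distrib exp_minus divide_inverse[symmetric])
qed

text \<open>With \<open>s = 1 / x\<close>, the chain rule multiplies by \<open>- s\<^sup>2\<close>
  and differentiates \<open>p s * exp (- s)\<close>, which again gives a polynomial in
  \<open>s\<close> times \<open>exp (- s)\<close>. Carrying the polynomial as a parameter thus makes
  the family closed under differentiation, as coinduction requires.\<close>

lemma DERIV_exp_cutoff:
  assumes p: "real_polynomial_function p" and dp: "\<And>s. (p has_real_derivative p' s) (at s)"
  shows "(exp_cutoff p has_real_derivative exp_cutoff (\<lambda>s. s\<^sup>2 * (p s - p' s)) x) (at x)"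
proof -
  consider "x < 0" | "x = 0" | "x > 0" by linarith
  then show ?thesis
  proof cases
    case 1
    have "((\<lambda>x. 0) has_real_derivative 0) (at x)" by simp
    then have "(exp_cutoff p has_real_derivative 0) (at x)"
      by (rule has_field_derivative_transform_within_open[where S = "{..<0}"])
        (use 1 in \<open>auto simp: exp_cutoff_def\<close>)
    then show ?thesis using 1 by (simp add: exp_cutoff_def)
  next
    case 3
    have "((\<lambda>x. p (1 / x) * exp (- (1 / x))) has_real_derivative
        (1/x)\<^sup>2 * (p (1/x) - p' (1/x)) * exp (- (1/x))) (at x)"
      by (rule derivative_eq_intros DERIV_chain2[OF dp] refl | use 3 in \<open>simp add: field_simps power2_eq_square\<close>)+
    then have "(exp_cutoff p has_real_derivative (1/x)\<^sup>2 * (p (1/x) - p' (1/x)) * exp (- (1/x))) (at x)"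
      by (rule has_field_derivative_transform_within_open[where S = "{0<..}"])
        (use 3 in \<open>auto simp: exp_cutoff_def\<close>)
    then show ?thesis using 3 by (simp add: exp_cutoff_def)
  next
    case 2
    \<comment> \<open>At 0 the right difference quotient with increment \<open>h\<close> is
      \<open>s * p s * exp (- s)\<close> for \<open>s = 1 / h\<close>: dividing by \<open>h\<close>
      costs one more power of \<open>s\<close>, which the exponential absorbs. The left quotient is
      identically 0.\<close>
    have "((\<lambda>s. (s * p s) * exp (- s)) \<longlongrightarrow> 0) at_top"
      by (intro real_polynomial_function_exp_tendsto_0)
        (intro real_polynomial_function.intros(1,4) p bounded_linear_ident)
    then have "((\<lambda>h. (inverse h * p (inverse h)) * exp (- inverse h)) \<longlongrightarrow> 0) (at_right 0)"
      by (rule filterlim_compose) (rule filterlim_inverse_at_top_right)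
    then have r: "((\<lambda>h. (exp_cutoff p (0 + h) - exp_cutoff p 0) / h) \<longlongrightarrow> 0) (at_right 0)"
      by (rule Lim_transform_eventually)
        (auto simp: exp_cutoff_def field_simps eventually_at_filter)
    have l: "((\<lambda>h. (exp_cutoff p (0 + h) - exp_cutoff p 0) / h) \<longlongrightarrow> 0) (at_left 0)"
      by (rule Lim_transform_eventually[OF tendsto_const])
        (auto simp: exp_cutoff_def eventually_at_filter)
    show ?thesis using filterlim_split_at[OF l r] 2
      by (simp add: DERIV_def exp_cutoff_def)
  qed
qed

lemma smooth_on_exp_cutoff: "smooth_on UNIV (exp_cutoff (\<lambda>_. 1))"
proof (rule smooth_on_UNIV_coinduct(1))
  show "exp_cutoff (\<lambda>_. 1) \<in> exp_cutoff ` Collect real_polynomial_function"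
    by (auto intro: real_polynomial_function.intros)
next
  fix g assume "g \<in> exp_cutoff ` Collect real_polynomial_function"
  then obtain p where p: "g = exp_cutoff p" "real_polynomial_function p" by auto
  then obtain p' where p': "real_polynomial_function p'" "\<And>x. (p has_real_derivative p' x) (at x)"
    using has_real_derivative_polynomial_function by blast
  have "real_polynomial_function (\<lambda>s. s\<^sup>2 * (p s - p' s))"
    by (intro real_polynomial_function.intros(1,4) bounded_linear_ident
      real_polynomial_function_power real_polynomial_function_diff p(2) p'(1))
  then show "\<exists>g'\<in>exp_cutoff ` Collect real_polynomial_function. \<forall>x. (g has_real_derivative g' x) (at x)"
    using DERIV_exp_cutoff[OF p(2) p'(2)] p(1) by blast
qed

lemma smooth_bump:
  assumes "r > 0"
  obtains \<rho> where "smooth_on UNIV \<rho>" "\<And>x. \<rho> x \<ge> 0" "\<And>x. \<bar>x\<bar> \<ge> r \<Longrightarrow> \<rho> x = 0"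
    "integral {-r..r} \<rho> = 1"
proof -
  define f where "f = exp_cutoff (\<lambda>_. 1)"
  \<comment> \<open>The two factors are both positive exactly when \<bar>x\<bar> < r; only the
    normalisation of the integral is missing.\<close>
  define g where "g x = f (r + 1 * x) * f (r + (-1) * x)" for x
  have f: "f x \<ge> 0" "x \<le> 0 \<Longrightarrow> f x = 0" "x > 0 \<Longrightarrow> f x > 0" for x
    by (auto simp: f_def exp_cutoff_def)
  have g: "smooth_on UNIV g"
    unfolding g_def f_def
    by (intro smooth_on_mult smooth_on_affine smooth_on_exp_cutoff)
  then have cont: "continuous_on A g" for A
    using smooth_on_continuous_higher_deriv[of g A 0] by simp
  have pos: "integral {-r..r} g > 0"
  proof -
    have "integral {-r..r} g \<noteq> 0"
    proof
      assume "integral {-r..r} g = 0"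
      then have "\<forall>x\<in>{-r..r}. g x = 0"
        using integral_eq_0_iff[of "-r" r g] assms cont f(1) by (simp add: g_def)
      then have "g 0 = 0" using assms by simp
      then show False using f(3)[of r] assms by (simp add: g_def)
    qed
    moreover have "integral {-r..r} g \<ge> 0"
      by (rule integral_nonneg[OF integrable_continuous_interval[OF cont]]) (simp add: g_def f)
    ultimately show ?thesis by linarith
  qed
  have zero: "g x = 0" if "\<bar>x\<bar> \<ge> r" for x
    using f(2)[of "r + x"] f(2)[of "r - x"] that by (auto simp: g_def abs_if split: if_splits)
  have nonneg: "g x \<ge> 0" for x by (simp add: g_def f)
  define c where "c = integral {-r..r} g"
  show thesis
  proof (rule that[of "\<lambda>x. 0 + (1 / c) * g x"])
    show "smooth_on UNIV (\<lambda>x. 0 + (1 / c) * g x)"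
      by (intro smooth_on_add_scaled smooth_on_zero g)
  qed (use pos zero nonneg in \<open>auto simp: c_def\<close>)
qed

lemma test_fun_smooth: "test_fun \<phi> \<Longrightarrow> smooth_on UNIV \<phi>"
  by (simp add: test_fun_def)

lemma higher_deriv_eq_0_outside:
  assumes "closed K" "\<And>x. x \<notin> K \<Longrightarrow> f x = 0" "x \<notin> K"
  shows "(deriv ^^ k) f x = (0::real)"
  using assms(3)
proof (induction k arbitrary: x)
  case 0 then show ?case using assms by simp
next
  case (Suc k)
  have "((\<lambda>x. 0) has_real_derivative 0) (at x)" by simp
  then have "((deriv ^^ k) f has_real_derivative 0) (at x)"
    by (rule has_field_derivative_transform_within_open[where S = "- K"])
      (use Suc assms(1) in \<open>auto\<close>)
  then show ?case by (simp add: DERIV_imp_deriv)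
qed

lemma smooth_compact_support_bounded:
  assumes "smooth_on UNIV f" "\<And>x. x \<notin> {a..b} \<Longrightarrow> f x = 0"
  obtains B where "\<And>x. \<bar>(deriv ^^ k) f x\<bar> \<le> B"
proof -
  have "bounded ((deriv ^^ k) f ` {a..b})"
    using assms(1) by (intro compact_imp_bounded compact_continuous_image
        smooth_on_continuous_higher_deriv) auto
  then obtain B where B: "\<forall>x\<in>{a..b}. \<bar>(deriv ^^ k) f x\<bar> \<le> B"
    by (auto simp: bounded_iff)
  have "\<bar>(deriv ^^ k) f x\<bar> \<le> max B 0" for x
  proof (cases "x \<in> {a..b}")
    case True
    then show ?thesis using B by force
  next
    case False
    then show ?thesis using higher_deriv_eq_0_outside[of "{a..b}" f x k] assms(2) by simp
  qed
  then show thesis by (rule that)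
qed

section \<open>Approximation of distributions\<close>

lemma test_fun_zero: "test_fun (\<lambda>x. 0)"
  unfolding test_fun_def by (intro conjI smooth_on_zero exI[of _ "1/2"]) auto

lemma test_fun_add_scaled:
  assumes "test_fun f" "test_fun g"
  shows "test_fun (\<lambda>x. f x + c * g x)"
proof -
  obtain a b a' b' where "0 < a" "b < 1" "\<forall>x. x \<notin> {a..b} \<longrightarrow> f x = 0"
    "0 < a'" "b' < 1" "\<forall>x. x \<notin> {a'..b'} \<longrightarrow> g x = 0"
    using assms by (auto simp: test_fun_def)
  then have "0 < min a a'" "max b b' < 1" "\<forall>x. x \<notin> {min a a'..max b b'} \<longrightarrow> f x + c * g x = 0"
    by (auto simp: min_le_iff_disj le_max_iff_disj)
  then show ?thesis
    unfolding test_fun_def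
    using smooth_on_add_scaled(1)[OF test_fun_smooth[OF assms(1)] test_fun_smooth[OF assms(2)]] by blast
qed

lemma distribution01_add_scaled:
  assumes "distribution01 D" "test_fun f" "test_fun g"
  shows "D (\<lambda>x. f x + c * g x) = D f + c * D g"
proof -
  have "test_fun (\<lambda>x. c * g x)" using test_fun_add_scaled[OF test_fun_zero assms(3), of c] by simp
  then show ?thesis using assms by (auto simp: distribution01_def)
qed

lemma distribution01_sum:
  fixes n :: nat
  assumes "distribution01 D" "\<And>i. test_fun (f i)"
  shows "test_fun (\<lambda>x. \<Sum>i<n. c i * f i x)"
    and "D (\<lambda>x. \<Sum>i<n. c i * f i x) = (\<Sum>i<n. c i * D (f i))"
proof -
  have "D (\<lambda>x. 0 * (\<lambda>x. 0) x) = 0 * D (\<lambda>x. 0)"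
    using assms(1) test_fun_zero unfolding distribution01_def by blast
  then have D0: "D (\<lambda>x. 0) = 0" by simp
  have "test_fun (\<lambda>x. \<Sum>i<n. c i * f i x) \<and>
    D (\<lambda>x. \<Sum>i<n. c i * f i x) = (\<Sum>i<n. c i * D (f i))"
    by (induction n) (simp_all add: D0 test_fun_zero test_fun_add_scaled
        distribution01_add_scaled[OF assms(1)] assms(2))
  then show "test_fun (\<lambda>x. \<Sum>i<n. c i * f i x)"
    and "D (\<lambda>x. \<Sum>i<n. c i * f i x) = (\<Sum>i<n. c i * D (f i))"
    by auto
qed

text \<open>The support of \<open>f\<close> inside (0,1) kills the boundary terms. This moves
  derivatives from the kernel, where they grow as its radius shrinks, to the test function, where
  they are bounded independently of the radius.\<close>

lemma integral_higher_deriv_by_parts: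
  assumes "smooth_on UNIV f" "smooth_on UNIV g" "0 < a" "b < 1" "\<And>x. x \<notin> {a..b} \<Longrightarrow> f x = 0"
  shows "integral {0..1} (\<lambda>x. f x * (deriv ^^ k) g x) =
    (-1) ^ k * integral {0..1} (\<lambda>x. (deriv ^^ k) f x * g x)"
  using assms(1,5)
proof (induction k arbitrary: f)
  case (Suc k)
  let ?G = "(deriv ^^ k) g"
  have df: "deriv f x = 0" if "x \<notin> {a..b}" for x
    using higher_deriv_eq_0_outside[OF _ Suc.prems(2) that, where k = 1] by simp
  have cdf: "continuous_on A (deriv f)" for A
    using smooth_on_continuous_higher_deriv[OF Suc.prems(1), of A 1] by simp
  have d: "((\<lambda>x. f x * ?G x) has_real_derivative f x * deriv ?G x + deriv f x * ?G x) (at x)" for x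
    using DERIV_mult[OF smooth_on_DERIV[OF Suc.prems(1), of x 0] smooth_on_DERIV[OF assms(2), of x k]]
    by (simp add: algebra_simps)
  have "((\<lambda>x. f x * deriv ?G x + deriv f x * ?G x) has_integral f 1 * ?G 1 - f 0 * ?G 0) {0..1}"
    by (rule fundamental_theorem_of_calculus[of 0 1 "\<lambda>x. f x * ?G x"])
      (simp_all add: d has_field_derivative_at_within flip: has_real_derivative_iff_has_vector_derivative)
  then have "((\<lambda>x. f x * deriv ?G x + deriv f x * ?G x) has_integral 0) {0..1}"
    using assms(3,4) by (simp add: Suc.prems(2))
  moreover have "(\<lambda>x. f x * deriv ?G x) integrable_on {0..1}"
    by (intro integrable_continuous_interval continuous_on_mult)
      (use smooth_on_continuous_higher_deriv[OF Suc.prems(1), of _ 0]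
         smooth_on_continuous_higher_deriv[OF assms(2), of _ "Suc k"] in auto)
  moreover have "(\<lambda>x. deriv f x * ?G x) integrable_on {0..1}"
    by (intro integrable_continuous_interval continuous_on_mult cdf
         smooth_on_continuous_higher_deriv[OF assms(2)])
  ultimately have "integral {0..1} (\<lambda>x. f x * deriv ?G x) = - integral {0..1} (\<lambda>x. deriv f x * ?G x)"
    by (simp add: integral_add[symmetric] integral_unique eq_neg_iff_add_eq_0)
  also have "\<dots> = - ((-1) ^ k * integral {0..1} (\<lambda>x. (deriv ^^ k) (deriv f) x * g x))"
    by (subst Suc.IH[OF smooth_on_deriv[OF Suc.prems(1)] df]) simp_all
  finally show ?case by (simp add: funpow_swap1)
qed simp

section \<open>Quantitative Riemann sums and mollification\<close>

lemma lipschitz_of_bounded_derivative: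
  assumes "\<And>x. (f has_real_derivative f' x) (at x)" "\<And>x. \<bar>f' x\<bar> \<le> L"
  shows "\<bar>f x - f y\<bar> \<le> L * \<bar>x - (y::real)\<bar>"
  using field_differentiable_bound[of UNIV f f' L x y] assms by simp

lemma riemann_sum_error:
  assumes cont: "continuous_on UNIV F" and lip: "\<And>x y. \<bar>F x - F y\<bar> \<le> L * \<bar>x - (y::real)\<bar>"
    and N: "N > (0::nat)"
  shows "\<bar>(\<Sum>j<N. F (j / N) / N) - integral {0..1} F\<bar> \<le> L / N"
proof -
  have L: "L \<ge> 0" using lip[of 1 0] by simp
  have cF: "continuous_on A F" for A using cont continuous_on_subset by blast
  have int: "F integrable_on {a..b}" for a b
    by (intro integrable_continuous_interval cF)
  have "\<bar>(\<Sum>j<m. F (j / N) / N) - integral {0..m / N} F\<bar> \<le> m * (L / N / N)" for m :: nat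
  proof (induction m)
    case (Suc m)
    have le: "real m / N \<le> Suc m / N" by (rule divide_right_mono) auto
    have split: "integral {0..m / N} F + integral {m / N..Suc m / N} F = integral {0..Suc m / N} F"
      by (rule Henstock_Kurzweil_Integration.integral_combine[OF _ le int]) simp
    have "\<bar>integral {m / N..Suc m / N} (\<lambda>x. F x - F (m / N))\<bar> \<le> (L / N) * (Suc m / N - m / N)"
    proof (rule integral_bound[where 'a = real, simplified real_norm_def])
      show "\<bar>F x - F (m / N)\<bar> \<le> L / N" if "x \<in> {m / N..Suc m / N}" for x
      proof -
        have "\<bar>x - m / N\<bar> \<le> 1 / N" using that by (auto simp: add_divide_distrib)
        then have "L * \<bar>x - m / N\<bar> \<le> L * (1 / N)" using L by (rule mult_left_mono)
        then show ?thesis using lip[of x "m / N"] by simp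
      qed
    qed (intro continuous_intros cF le)+
    moreover have "integral {m / N..Suc m / N} (\<lambda>x. F x - F (m / N)) =
        integral {m / N..Suc m / N} F - F (m / N) / N"
      using le by (subst Henstock_Kurzweil_Integration.integral_diff[OF int])
        (auto simp: add_divide_distrib ring_distribs)
    ultimately have "\<bar>integral {m / N..Suc m / N} F - F (m / N) / N\<bar> \<le> L / N / N"
      by (simp add: add_divide_distrib)
    then show ?case using Suc split by (simp add: ring_distribs add_divide_distrib mult.commute)
  qed simp
  from this[of N] N show ?thesis by simp
qed

text \<open>As the kernel has mass one, the error is a weighted mean of the differences of
  \<open>\<phi>\<close> over points at distance less than \<open>r\<close> from \<open>y\<close>.
  The conditions on \<open>y\<close> keep the whole kernel inside [0,1].\<close>

lemma mollify_error:
  assumes cont: "continuous_on UNIV \<rho>" and nonneg: "\<And>x. \<rho> x \<ge> 0"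
    and supp: "\<And>x. \<bar>x\<bar> \<ge> r \<Longrightarrow> \<rho> x = 0" and one: "integral {-r..r} \<rho> = 1"
    and lip: "\<And>x y. \<bar>\<phi> x - \<phi> y\<bar> \<le> L * \<bar>x - (y::real)\<bar>" and c\<phi>: "continuous_on UNIV \<phi>"
    and y: "0 \<le> y - r" "y + r \<le> 1"
  shows "\<bar>integral {0..1} (\<lambda>x. \<phi> x * \<rho> (x - y)) - \<phi> y\<bar> \<le> L * r"
proof -
  have L: "L \<ge> 0" using lip[of 1 0] by simp
  have c\<rho>: "continuous_on A (\<lambda>x. \<rho> (x - y))" for A
    by (rule continuous_on_compose2[OF cont]) (auto intro!: continuous_intros)
  have c\<phi>': "continuous_on A \<phi>" for A using c\<phi> continuous_on_subset by blast
  have "integral {y - r..y + r} (\<lambda>x. \<rho> (x - y)) = 1"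
    using integral_shift[of "y - r" "- y" "y + r" \<rho>] one continuous_on_subset[OF cont]
    by (simp add: o_def)
  then have "((\<lambda>x. \<rho> (x - y)) has_integral 1) {y - r..y + r}"
    by (metis c\<rho> integrable_continuous_interval integrable_integral)
  then have i1: "((\<lambda>x. \<rho> (x - y)) has_integral 1) {0..1}"
    by (rule has_integral_on_superset) (use y supp in \<open>auto simp: abs_if not_le\<close>)
  have "\<bar>integral {0..1} (\<lambda>x. (\<phi> x - \<phi> y) * \<rho> (x - y))\<bar> \<le> integral {0..1} (\<lambda>x. L * r * \<rho> (x - y))"
  proof (rule integral_norm_bound_integral[where 'a = real, simplified real_norm_def])
    fix x :: real
    show "\<bar>(\<phi> x - \<phi> y) * \<rho> (x - y)\<bar> \<le> L * r * \<rho> (x - y)"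
    proof (cases "\<bar>x - y\<bar> \<ge> r")
      case False
      then have "L * \<bar>x - y\<bar> \<le> L * r" using L by (intro mult_left_mono) auto
      then have "\<bar>\<phi> x - \<phi> y\<bar> \<le> L * r" using lip[of x y] by linarith
      then show ?thesis using nonneg by (simp add: abs_mult mult_right_mono)
    qed (simp add: supp)
  qed (auto intro!: integrable_continuous_interval continuous_intros c\<rho> c\<phi>')
  also have "\<dots> = L * r" using i1 by (simp add: integral_unique)
  also have "integral {0..1} (\<lambda>x. (\<phi> x - \<phi> y) * \<rho> (x - y)) =
      integral {0..1} (\<lambda>x. \<phi> x * \<rho> (x - y)) - \<phi> y * integral {0..1} (\<lambda>x. \<rho> (x - y))"
    unfolding left_diff_distrib
    by (subst Henstock_Kurzweil_Integration.integral_diff)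
      (auto intro!: integrable_continuous_interval continuous_intros c\<rho> c\<phi>')
  finally show ?thesis using i1 by (simp add: integral_unique)
qed

text \<open>Mollification by a Riemann sum instead of an integral: the distribution only has to be
  applied to a finite linear combination of translates of a bump function.\<close>
lemma distribution01_approx_points:
  fixes r :: real
  assumes D: "distribution01 D" and r: "0 < r"
  obtains N :: nat and c where "N > 0"
    "\<And>j. c j \<noteq> 0 \<Longrightarrow> 0 < j / N \<and> j / N < 1"
    "\<And>\<phi> a b C (m::nat) K. test_fun \<phi> \<Longrightarrow> \<forall>x. x \<notin> {a..b} \<longrightarrow> \<phi> x = 0 \<Longrightarrow> 3 * r < a \<Longrightarrow> b + 3 * r < 1 \<Longrightarrow>
      m * r \<le> 1 \<Longrightarrow> 0 \<le> C \<Longrightarrow>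
      (\<And>\<phi>. test_fun \<phi> \<Longrightarrow> \<forall>x. x \<notin> {a - r..b + r} \<longrightarrow> \<phi> x = 0 \<Longrightarrow>
         \<bar>D \<phi>\<bar> \<le> C * (\<Sum>k\<le>m. (SUP x. \<bar>(deriv ^^ k) \<phi> x\<bar>))) \<Longrightarrow>
      (\<And>k x. k \<le> Suc m \<Longrightarrow> \<bar>(deriv ^^ k) \<phi> x\<bar> \<le> K) \<Longrightarrow>
      \<bar>(\<Sum>j<N. c j * \<phi> (j / N)) - D \<phi>\<bar> \<le> C * (Suc m * (2 * K * r))"
proof -
  obtain \<rho> where \<rho>: "smooth_on UNIV \<rho>" "\<And>x. \<rho> x \<ge> 0" "\<And>x. \<bar>x\<bar> \<ge> r \<Longrightarrow> \<rho> x = 0"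
    "integral {-r..r} \<rho> = 1"
    using smooth_bump[OF r] by metis
  have "\<exists>B. \<forall>x. \<bar>(deriv ^^ k) \<rho> x\<bar> \<le> B" for k
  proof -
    have "\<rho> x = 0" if "x \<notin> {-r..r}" for x using \<rho>(3)[of x] that by (auto simp: abs_if)
    then show ?thesis using smooth_compact_support_bounded[OF \<rho>(1), of "-r" r k] by blast
  qed
  then obtain B where B: "\<And>k x. \<bar>(deriv ^^ k) \<rho> x\<bar> \<le> B k" by metis
  have B0: "B k \<ge> 0" for k using B[of k 0] abs_ge_zero order_trans by blast
  \<comment> \<open>\<open>N\<close> and \<open>c\<close> must not depend on the order
    \<open>m\<close>, which comes with the test function. The hypothesis
    \<open>m * r \<le> 1\<close> bounds the relevant orders by \<open>n0\<close>, a number depending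
    on \<open>r\<close> only.\<close>
  define n0 where "n0 = nat \<lceil>1 / r\<rceil>"
  \<comment> \<open>So fine a grid that the Riemann sum error is at most \<open>K * r\<close> for
    every order up to \<open>n0\<close>: the integrands below have Lipschitz constant
    \<open>K * (B k + B (Suc k))\<close>, and each of these two terms is at most the whole
    sum.\<close>
  define N where "N = Suc (nat \<lceil>2 * (\<Sum>k\<le>Suc n0. B k) / r\<rceil>)"
  have N: "N > 0" by (simp add: N_def)
  have NB: "(B k + B (Suc k)) / N \<le> r" if "k \<le> n0" for k
  proof -
    have "B k + B (Suc k) \<le> 2 * (\<Sum>k\<le>Suc n0. B k)"
      using member_le_sum[of k "{..Suc n0}" B] member_le_sum[of "Suc k" "{..Suc n0}" B] B0 that by auto
    also have "\<dots> \<le> r * N"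
    proof -
      have "2 * (\<Sum>k\<le>Suc n0. B k) / r \<le> N" unfolding N_def by linarith
      then show ?thesis using r by (simp add: field_simps)
    qed
    finally show ?thesis using N by (simp add: field_simps)
  qed
  \<comment> \<open>Translates centred too close to the boundary are replaced by 0, so that every
    \<open>\<theta> j\<close> is a test function, supported in [r, 1 - r]. The admissible \<phi>
    vanish at those centres, so nothing is lost.\<close>
  define \<theta> where "\<theta> j = (if 2 * r \<le> real j / N \<and> real j / N \<le> 1 - 2 * r
      then (\<lambda>y. \<rho> (real j / N + (-1) * y)) else (\<lambda>y. 0))" for j
  have test: "test_fun (\<theta> j)" for j
  proof (cases "2 * r \<le> real j / N \<and> real j / N \<le> 1 - 2 * r")
    case True
    have "\<theta> j x = 0" if "x \<notin> {r..1 - r}" for x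
      using \<rho>(3)[of "real j / N + (-1) * x"] True that by (auto simp: \<theta>_def abs_if)
    moreover have "smooth_on UNIV (\<theta> j)"
      using True by (simp only: \<theta>_def if_True smooth_on_affine \<rho>(1) simp_thms)
    ultimately show ?thesis unfolding test_fun_def using r by (intro conjI exI[of _ r] exI[of _ "1 - r"]) auto
  next
    case False
    then show ?thesis using test_fun_zero unfolding \<theta>_def by presburger
  qed
  have D0: "D (\<lambda>x. 0) = 0" using distribution01_sum(2)[OF D, where f = "\<lambda>_ _. 0" and n = 0] test_fun_zero by simp
  \<comment> \<open>By linearity, summing \<open>c j * \<phi> (j / N)\<close> applies
    \<open>D\<close> to the Riemann sum of the convolution of \<phi> with \<rho>.\<close>
  define c where "c j = D (\<theta> j) / N" for j
  show thesis
  proof (rule that[of N c, OF N])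
    fix j assume "c j \<noteq> 0"
    then have "\<theta> j \<noteq> (\<lambda>y. 0)" using D0 by (auto simp: c_def)
    then have "2 * r \<le> real j / N \<and> real j / N \<le> 1 - 2 * r" unfolding \<theta>_def by presburger
    then show "0 < real j / N \<and> real j / N < 1" using r by linarith
  next
    fix \<phi> a b C m K
    assume \<phi>: "test_fun \<phi>" "\<forall>x. x \<notin> {a..b} \<longrightarrow> \<phi> x = 0" and a: "3 * r < a" and b: "b + 3 * r < 1"
      and m: "real m * r \<le> 1" and C: "0 \<le> C"
      and bound: "\<And>\<phi>. test_fun \<phi> \<Longrightarrow> \<forall>x. x \<notin> {a - r..b + r} \<longrightarrow> \<phi> x = 0 \<Longrightarrow>
         \<bar>D \<phi>\<bar> \<le> C * (\<Sum>k\<le>m. (SUP x. \<bar>(deriv ^^ k) \<phi> x\<bar>))"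
      and K: "\<And>k x. k \<le> Suc m \<Longrightarrow> \<bar>(deriv ^^ k) \<phi> x\<bar> \<le> K"
    have mn0: "m \<le> n0"
    proof -
      have "real m \<le> 1 / r" using m r by (simp add: field_simps)
      then show ?thesis unfolding n0_def by linarith
    qed
    have K0: "K \<ge> 0" using K[of 0 0] by simp
    have s\<phi>: "smooth_on UNIV \<phi>" using \<phi>(1) by (rule test_fun_smooth)
    \<comment> \<open>The weight \<open>\<phi> (j / N)\<close> removes the case distinction in
      \<open>\<theta> j\<close>: it is zero wherever the second case applies.\<close>
    have \<theta>\<phi>: "\<phi> (real j / N) * (deriv ^^ k) (\<theta> j) y = \<phi> (real j / N) * ((-1) ^ k * (deriv ^^ k) \<rho> (real j / N + (-1) * y))"
      for j k y
    proof (cases "real j / N \<in> {a..b}")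
      case True
      then have "2 * r \<le> real j / N \<and> real j / N \<le> 1 - 2 * r" using a b r by auto
      then have "\<theta> j = (\<lambda>y. \<rho> (real j / N + (-1) * y))" by (simp only: \<theta>_def if_True simp_thms)
      then show ?thesis using smooth_on_affine(2)[OF \<rho>(1), of k "real j / N" "-1"] by (simp only:)
    qed (use \<phi>(2) in simp)
    \<comment> \<open>\<open>R\<close> is the discretised mollification of \<phi>. The continuity
      estimate for \<open>D\<close> needs all derivatives of \<open>E\<close> up to order
      \<open>m\<close> to be small; each is bounded by one Riemann sum error and one mollification
      error, both at most \<open>K * r\<close>.\<close>
    define R where "R y = (\<Sum>j<N. \<phi> (real j / N) / N * \<theta> j y)" for y
    define E where "E y = R y + (-1) * \<phi> y" for y
    have tR: "test_fun R" and DR: "D R = (\<Sum>j<N. \<phi> (real j / N) / N * D (\<theta> j))"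
      unfolding R_def by (rule distribution01_sum[OF D test])+
    have tE: "test_fun E" unfolding E_def using tR \<phi>(1) by (rule test_fun_add_scaled)
    have DE: "D E = D R - D \<phi>" unfolding E_def using distribution01_add_scaled[OF D tR \<phi>(1), of "-1"] by simp
    have suppE: "E y = 0" if "y \<notin> {a - r..b + r}" for y
    proof -
      have "\<phi> (real j / N) * \<theta> j y = 0" for j
      proof (cases "real j / N \<in> {a..b}")
        case True
        then have "\<bar>real j / N + (-1) * y\<bar> \<ge> r" using that by (auto simp: abs_if)
        then show ?thesis using \<theta>\<phi>[of j 0 y] \<rho>(3) by simp
      qed (use \<phi>(2) in simp)
      then have "R y = 0" unfolding R_def by (intro sum.neutral) (auto simp: field_simps)
      moreover have "\<phi> y = 0" using that \<phi>(2) r by auto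
      ultimately show ?thesis by (simp add: E_def)
    qed
    have Ek: "\<bar>(deriv ^^ k) E y\<bar> \<le> 2 * K * r" if k: "k \<le> m" for k y
    proof (cases "y \<in> {a - r..b + r}")
      case False
      then have "(deriv ^^ k) E y = 0" by (intro higher_deriv_eq_0_outside[of "{a - r..b + r}"] suppE) auto
      then show ?thesis using K0 r by simp
    next
      case True
      \<comment> \<open>From here on \<open>y\<close> is fixed and the node \<open>x\<close> is the
        variable: \<open>F\<close> below is the integrand whose Riemann sum is the
        \<open>k\<close>-th derivative of \<open>R\<close> at \<open>y\<close>.\<close>
      define G where "G l x = (deriv ^^ l) \<rho> ((- y) + 1 * x)" for l x
      have G: "(deriv ^^ l) (\<lambda>x. \<rho> ((- y) + 1 * x)) = G l" for l
        using smooth_on_affine(2)[OF \<rho>(1), of l "-y" 1] unfolding G_def by simp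
      have sG: "smooth_on UNIV (\<lambda>x. \<rho> ((- y) + 1 * x))" by (rule smooth_on_affine(1)[OF \<rho>(1)])
      have dG: "(G l has_real_derivative G (Suc l) x) (at x)" for l x
        using smooth_on_DERIV[OF sG, of x l] unfolding G by simp
      have d\<phi>: "(\<phi> has_real_derivative deriv \<phi> x) (at x)" for x
        using smooth_on_DERIV[OF s\<phi>, of x 0] by simp
      define F where "F x = \<phi> x * ((-1) ^ k * G k x)" for x
      define F' where "F' x = \<phi> x * ((-1) ^ k * G (Suc k) x) + deriv \<phi> x * ((-1) ^ k * G k x)" for x
      have dF: "(F has_real_derivative F' x) (at x)" for x
        unfolding F_def F'_def by (auto intro!: derivative_eq_intros d\<phi> dG)
      have "\<bar>F' x\<bar> \<le> K * B (Suc k) + K * B k" for x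
        unfolding F'_def
        by (rule order_trans[OF abs_triangle_ineq], rule add_mono)
          (use K[of 0 x] K[of 1 x] B[of k "x - y"] B[of "Suc k" "x - y"] K0 in \<open>auto simp: abs_mult G_def intro!: mult_mono\<close>)
      then have "\<bar>F u - F v\<bar> \<le> (K * B (Suc k) + K * B k) * \<bar>u - v\<bar>" for u v
        by (rule lipschitz_of_bounded_derivative[OF dF])
      moreover have "continuous_on UNIV F"
        using dF DERIV_isCont continuous_at_imp_continuous_on by blast
      ultimately have "\<bar>(\<Sum>j<N. F (real j / N) / N) - integral {0..1} F\<bar> \<le> (K * B (Suc k) + K * B k) / N"
        using riemann_sum_error N by blast
      also have "\<dots> = K * ((B k + B (Suc k)) / N)" by (simp add: field_simps)
      also have "\<dots> \<le> K * r" using NB[of k] k mn0 K0 by (intro mult_left_mono) auto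
      finally have 1: "\<bar>(\<Sum>j<N. F (real j / N) / N) - integral {0..1} F\<bar> \<le> K * r" .
      \<comment> \<open>Two signs \<open>(-1) ^ k\<close> cancel: one from differentiating the
        kernel in \<open>y\<close> instead of \<open>x\<close>, one from integration by parts. What
        remains is the mollification of the \<open>k\<close>-th derivative of \<phi>.\<close>
      have "integral {0..1} F = (-1) ^ k * integral {0..1} (\<lambda>x. \<phi> x * G k x)"
        unfolding F_def by (subst mult.left_commute) (rule integral_mult_right)
      also have "integral {0..1} (\<lambda>x. \<phi> x * G k x) =
          (-1) ^ k * integral {0..1} (\<lambda>x. (deriv ^^ k) \<phi> x * \<rho> (- y + 1 * x))"
        unfolding G[symmetric]
        by (rule integral_higher_deriv_by_parts[OF s\<phi> sG, of a b]) (use a b r \<phi>(2) in auto)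
      finally have 2: "integral {0..1} F = integral {0..1} (\<lambda>x. (deriv ^^ k) \<phi> x * \<rho> (x - y))"
        by (simp add: mult.assoc[symmetric] power_mult_distrib[symmetric])
      have lip: "\<bar>(deriv ^^ k) \<phi> u - (deriv ^^ k) \<phi> v\<bar> \<le> K * \<bar>u - v\<bar>" for u v
        by (rule lipschitz_of_bounded_derivative[OF smooth_on_DERIV[OF s\<phi> UNIV_I] K]) (use k in simp)
      have 3: "\<bar>integral {0..1} (\<lambda>x. (deriv ^^ k) \<phi> x * \<rho> (x - y)) - (deriv ^^ k) \<phi> y\<bar> \<le> K * r"
        using smooth_on_continuous_higher_deriv[OF \<rho>(1), of UNIV 0] True a b r
        by (intro mollify_error \<rho>(2-) lip smooth_on_continuous_higher_deriv s\<phi>) auto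
      have "(deriv ^^ k) E y = (deriv ^^ k) R y + (-1) * (deriv ^^ k) \<phi> y"
        unfolding E_def using smooth_on_add_scaled(2)[OF test_fun_smooth[OF tR] s\<phi>, of k "-1"] by simp
      also have "(deriv ^^ k) R y = (\<Sum>j<N. \<phi> (real j / N) / N * (deriv ^^ k) (\<theta> j) y)"
        unfolding R_def by (subst smooth_on_sum_scaled(2)[OF test_fun_smooth[OF test]]) (rule refl)
      also have "\<dots> = (\<Sum>j<N. F (real j / N) / N)"
      proof (rule sum.cong[OF refl])
        fix j
        have "\<phi> (real j / N) * (deriv ^^ k) (\<theta> j) y = F (real j / N)"
          using \<theta>\<phi>[of j k y] by (simp add: F_def G_def)
        then show "\<phi> (real j / N) / N * (deriv ^^ k) (\<theta> j) y = F (real j / N) / N" by (metis times_divide_eq_left)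
      qed
      finally show ?thesis using 1 2 3 by (simp add: algebra_simps)
    qed
    have "\<bar>D E\<bar> \<le> C * (\<Sum>k\<le>m. (SUP x. \<bar>(deriv ^^ k) E x\<bar>))"
      by (rule bound[OF tE]) (use suppE in blast)
    also have "\<dots> \<le> C * (\<Sum>k\<le>m. 2 * K * r)"
      by (intro mult_left_mono sum_mono cSUP_least Ek C) auto
    finally have "\<bar>D R - D \<phi>\<bar> \<le> C * (Suc m * (2 * K * r))" using DE by simp
    moreover have "D R = (\<Sum>j<N. c j * \<phi> (real j / N))" by (simp add: DR c_def mult.commute)
    ultimately show "\<bar>(\<Sum>j<N. c j * \<phi> (real j / N)) - D \<phi>\<bar> \<le> C * (Suc m * (2 * K * r))" by simp
  qed
qed

text \<open>Spreads point masses into narrow bumps. Since masses sit only at interior nodes, the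
  resulting function can vanish in a neighbourhood of both endpoints.\<close>

lemma approx_points_by_bumps:
  fixes N :: nat and c :: "nat \<Rightarrow> real"
  assumes c: "\<And>j. c j \<noteq> 0 \<Longrightarrow> 0 < j / N \<and> j / N < 1" and e: "e > 0"
  obtains g \<delta> where "continuous_on UNIV g" "\<delta> > 0" "\<And>x. x \<notin> {\<delta>..1 - \<delta>} \<Longrightarrow> g x = 0"
    "\<And>\<phi> L. (\<And>x y. \<bar>\<phi> x - \<phi> y\<bar> \<le> L * \<bar>x - y\<bar>) \<Longrightarrow> continuous_on UNIV \<phi> \<Longrightarrow>
      \<bar>integral {0..1} (\<lambda>x. g x * \<phi> x) - (\<Sum>j<N. c j * \<phi> (j / N))\<bar> \<le> L * e"
proof -
  define J where "J = {j. j < N \<and> c j \<noteq> 0}"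
  \<comment> \<open>The first entry keeps the total mass times the radius below \<open>e\<close>;
    the others leave room for a bump of radius \<open>r\<close> around each node and a further
    margin \<open>r\<close> to the boundary, which serves as \<open>\<delta>\<close>.\<close>
  define r where "r = Min (insert (e / (1 + (\<Sum>j<N. \<bar>c j\<bar>))) ((\<lambda>j. min (j / N) (1 - j / N) / 2) ` J))"
  have fin: "finite J" by (simp add: J_def)
  have pos: "1 + (\<Sum>j<N. \<bar>c j\<bar>) > 0" by (simp add: add_pos_nonneg sum_nonneg)
  have r: "r > 0" unfolding r_def using fin c e pos by (subst Min_gr_iff) (auto simp: J_def)
  have "r \<le> e / (1 + (\<Sum>j<N. \<bar>c j\<bar>))" unfolding r_def using fin by (intro Min_le) auto
  then have "r * (1 + (\<Sum>j<N. \<bar>c j\<bar>)) \<le> e" using pos by (simp add: field_simps)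
  then have re: "(\<Sum>j<N. \<bar>c j\<bar>) * r \<le> e" using r by (simp add: algebra_simps)
  have rj: "2 * r \<le> j / N" "2 * r \<le> 1 - j / N" if "j < N" "c j \<noteq> 0" for j
  proof -
    have "r \<le> min (j / N) (1 - j / N) / 2" unfolding r_def using fin that by (intro Min_le) (auto simp: J_def)
    then show "2 * r \<le> j / N" "2 * r \<le> 1 - j / N" by simp_all
  qed
  obtain \<rho> where \<rho>: "smooth_on UNIV \<rho>" "\<And>x. \<rho> x \<ge> 0" "\<And>x. \<bar>x\<bar> \<ge> r \<Longrightarrow> \<rho> x = 0"
    "integral {-r..r} \<rho> = 1"
    using smooth_bump[OF r] by metis
  have c\<rho>: "continuous_on UNIV \<rho>" using smooth_on_continuous_higher_deriv[OF \<rho>(1), of UNIV 0] by simp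
  have c\<rho>': "continuous_on A (\<lambda>x. \<rho> (x - y))" for A y
    by (rule continuous_on_compose2[OF c\<rho>]) (auto intro!: continuous_intros)
  define g where "g x = (\<Sum>j<N. c j * \<rho> (x - j / N))" for x
  show thesis
  proof (rule that[of g r])
    show "continuous_on UNIV g" unfolding g_def by (intro continuous_intros c\<rho>')
    show "g x = 0" if "x \<notin> {r..1 - r}" for x
      unfolding g_def
    proof (rule sum.neutral, rule ballI)
      fix j assume "j \<in> {..<N}"
      then show "c j * \<rho> (x - j / N) = 0"
        using rj[of j] \<rho>(3)[of "x - j / N"] that by (cases "c j = 0") (auto simp: abs_if)
    qed
  next
    fix \<phi> L assume lip: "\<And>x y. \<bar>\<phi> x - \<phi> y\<bar> \<le> L * \<bar>x - (y::real)\<bar>" and c\<phi>: "continuous_on UNIV \<phi>"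
    have L: "L \<ge> 0" using lip[of 1 0] by simp
    have c\<phi>': "continuous_on A \<phi>" for A using c\<phi> continuous_on_subset by blast
    have "integral {0..1} (\<lambda>x. g x * \<phi> x) = integral {0..1} (\<lambda>x. \<Sum>j<N. c j * (\<phi> x * \<rho> (x - j / N)))"
      by (simp add: g_def sum_distrib_right mult.assoc mult.commute[of "\<phi> _"])
    also have "\<dots> = (\<Sum>j<N. integral {0..1} (\<lambda>x. c j * (\<phi> x * \<rho> (x - j / N))))"
      by (intro integral_sum integrable_continuous_interval continuous_intros c\<rho>' c\<phi>') simp
    also have "\<dots> = (\<Sum>j<N. c j * integral {0..1} (\<lambda>x. \<phi> x * \<rho> (x - j / N)))" by simp
    finally have "integral {0..1} (\<lambda>x. g x * \<phi> x) - (\<Sum>j<N. c j * \<phi> (j / N)) =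
        (\<Sum>j<N. c j * (integral {0..1} (\<lambda>x. \<phi> x * \<rho> (x - j / N)) - \<phi> (j / N)))"
      by (simp add: right_diff_distrib sum_subtractf)
    also have "\<bar>\<dots>\<bar> \<le> (\<Sum>j<N. \<bar>c j\<bar> * (L * r))"
    proof (rule order_trans[OF sum_abs sum_mono])
      fix j assume j: "j \<in> {..<N}"
      show "\<bar>c j * (integral {0..1} (\<lambda>x. \<phi> x * \<rho> (x - j / N)) - \<phi> (j / N))\<bar> \<le> \<bar>c j\<bar> * (L * r)"
      proof (cases "c j = 0")
        case False
        have "\<bar>integral {0..1} (\<lambda>x. \<phi> x * \<rho> (x - j / N)) - \<phi> (j / N)\<bar> \<le> L * r"
          by (rule mollify_error[OF c\<rho> \<rho>(2-4) lip c\<phi>]) (use rj[of j] False j r in auto)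
        then show ?thesis by (simp add: abs_mult mult_left_mono)
      qed simp
    qed
    also have "\<dots> = L * ((\<Sum>j<N. \<bar>c j\<bar>) * r)" by (simp add: sum_distrib_left sum_distrib_right mult_ac)
    also have "\<dots> \<le> L * e" using re L by (rule mult_left_mono)
    finally show "\<bar>integral {0..1} (\<lambda>x. g x * \<phi> x) - (\<Sum>j<N. c j * \<phi> (j / N))\<bar> \<le> L * e" .
  qed (rule r)
qed

lemma distribution01_approx_continuous:
  assumes D: "distribution01 D"
  obtains g \<delta> where "\<And>n::nat. continuous_on UNIV (g n)" "\<And>n. \<delta> n > (0::real)"
    "\<And>n x. x \<notin> {\<delta> n..1 - \<delta> n} \<Longrightarrow> g n x = (0::real)"
    "\<And>\<phi>. test_fun \<phi> \<Longrightarrow> (\<lambda>n. integral {0..1} (\<lambda>x. g n x * \<phi> x)) \<longlonglongrightarrow> D \<phi>"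
proof -
  define r where "r n = 1 / real (Suc n)" for n
  have r: "r n > 0" for n by (simp add: r_def)
  \<comment> \<open>Admissibility at scale \<open>\<rho>\<close> collects everything the error bound
    depends on. Quantifying over all of it inside \<open>approx\<close> allows \<open>g n\<close> to
    be chosen before any test function is given.\<close>
  define good where "good \<rho> \<phi> a b C m K \<longleftrightarrow> test_fun \<phi> \<and> (\<forall>x. x \<notin> {a..b} \<longrightarrow> \<phi> x = 0) \<and>
      3 * \<rho> < a \<and> b + 3 * \<rho> < 1 \<and> real m * \<rho> \<le> 1 \<and> 0 \<le> C \<and>
      (\<forall>\<phi>. test_fun \<phi> \<longrightarrow> (\<forall>x. x \<notin> {a - \<rho>..b + \<rho>} \<longrightarrow> \<phi> x = 0) \<longrightarrow>
         \<bar>D \<phi>\<bar> \<le> C * (\<Sum>k\<le>m. (SUP x. \<bar>(deriv ^^ k) \<phi> x\<bar>))) \<and>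
      (\<forall>k x. k \<le> Suc m \<longrightarrow> \<bar>(deriv ^^ k) \<phi> x\<bar> \<le> K)" for \<rho> \<phi> a b C m K
  define approx where "approx n g \<delta> \<longleftrightarrow> continuous_on UNIV g \<and> \<delta> > 0 \<and> (\<forall>x. x \<notin> {\<delta>..1 - \<delta>} \<longrightarrow> g x = 0) \<and>
    (\<forall>\<phi> a b C m K. good (r n) \<phi> a b C m K \<longrightarrow>
      \<bar>integral {0..1} (\<lambda>x. g x * \<phi> x) - D \<phi>\<bar> \<le> C * (Suc m * (2 * K * r n)) + K * r n)" for n g \<delta>
  have "\<exists>g \<delta>. approx n g \<delta>" for n
  proof -
    obtain N :: nat and c where c: "\<And>j. c j \<noteq> 0 \<Longrightarrow> 0 < j / N \<and> j / N < 1" and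
      points: "\<And>\<phi> a b C m K. good (r n) \<phi> a b C m K \<Longrightarrow>
        \<bar>(\<Sum>j<N. c j * \<phi> (j / N)) - D \<phi>\<bar> \<le> C * (Suc m * (2 * K * r n))"
    proof (rule distribution01_approx_points[OF D r[of n]], goal_cases)
      case (1 N c)
      show thesis
      proof (rule 1(1)[of c N, OF 1(3)])
        fix \<phi> a b C m K assume "good (r n) \<phi> a b C m K"
        then show "\<bar>(\<Sum>j<N. c j * \<phi> (j / N)) - D \<phi>\<bar> \<le> C * (Suc m * (2 * K * r n))"
          by (intro 1(4)[where a = a and b = b]) (simp_all add: good_def)
      qed
    qed
    obtain g \<delta> where g: "continuous_on UNIV g" "\<delta> > 0" "\<And>x. x \<notin> {\<delta>..1 - \<delta>} \<Longrightarrow> g x = 0"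
      "\<And>\<phi> L. (\<And>x y. \<bar>\<phi> x - \<phi> y\<bar> \<le> L * \<bar>x - y\<bar>) \<Longrightarrow> continuous_on UNIV \<phi> \<Longrightarrow>
        \<bar>integral {0..1} (\<lambda>x. g x * \<phi> x) - (\<Sum>j<N. c j * \<phi> (j / N))\<bar> \<le> L * r n"
      proof (rule approx_points_by_bumps[where c = c and N = N, OF c r[of n]], goal_cases)
      case (2 g \<delta>)
      show thesis by (rule 2(1)[OF 2(2-5)])
    qed
    have "\<bar>integral {0..1} (\<lambda>x. g x * \<phi> x) - D \<phi>\<bar> \<le> C * (Suc m * (2 * K * r n)) + K * r n"
      if good: "good (r n) \<phi> a b C m K" for \<phi> a b C m K
    proof -
      have s: "smooth_on UNIV \<phi>" using good by (simp add: good_def test_fun_smooth)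
      have K: "\<bar>deriv \<phi> x\<bar> \<le> K" for x
      proof -
        have "\<forall>k x. k \<le> Suc m \<longrightarrow> \<bar>(deriv ^^ k) \<phi> x\<bar> \<le> K" using good by (simp add: good_def)
        from this[rule_format, of 1 x] show ?thesis by simp
      qed
      have d\<phi>: "(\<phi> has_real_derivative deriv \<phi> x) (at x)" for x
        using smooth_on_DERIV[OF s, of x 0] by simp
      have c\<phi>: "continuous_on UNIV \<phi>" using smooth_on_continuous_higher_deriv[OF s, of UNIV 0] by simp
      from g(4)[OF lipschitz_of_bounded_derivative[OF d\<phi> K] c\<phi>] points[OF good]
      show ?thesis by linarith
    qed
    then have "approx n g \<delta>" unfolding approx_def using g(1-3) by (intro conjI allI impI)
    then show ?thesis by blast
  qed
  then obtain g \<delta> where approx: "\<And>n. approx n (g n) (\<delta> n)" by metis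
  have g: "\<And>n. continuous_on UNIV (g n)" "\<And>n. \<delta> n > 0"
    "\<And>n x. x \<notin> {\<delta> n..1 - \<delta> n} \<Longrightarrow> g n x = 0"
    "\<And>n \<phi> a b C m K. good (r n) \<phi> a b C m K \<Longrightarrow>
      \<bar>integral {0..1} (\<lambda>x. g n x * \<phi> x) - D \<phi>\<bar> \<le> C * (Suc m * (2 * K * r n)) + K * r n"
    using approx by (simp_all add: approx_def)
  show thesis
  proof (rule that[of g \<delta>, OF g(1-3)])
    fix \<phi> assume \<phi>: "test_fun \<phi>"
    then obtain a b where ab: "0 < a" "b < 1" "\<forall>x. x \<notin> {a..b} \<longrightarrow> \<phi> x = 0"
      by (auto simp: test_fun_def)
    obtain C' m where C': "\<And>\<phi>. test_fun \<phi> \<Longrightarrow> \<forall>x. x \<notin> {a / 2..(b + 1) / 2} \<longrightarrow> \<phi> x = 0 \<Longrightarrow>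
         \<bar>D \<phi>\<bar> \<le> C' * (\<Sum>k\<le>(m::nat). (SUP x. \<bar>(deriv ^^ k) \<phi> x\<bar>))"
    proof -
      \<comment> \<open>One fixed compact set, strictly larger than \<open>{a..b}\<close>, gives
        constants independent of \<open>n\<close>; it contains \<open>{a - r n..b + r n}\<close> for
        all large \<open>n\<close>.\<close>
      have "0 < a / 2" "(b + 1) / 2 < 1" using ab by auto
      then show thesis using D that unfolding distribution01_def by blast
    qed
    have "\<exists>B. \<forall>x. \<bar>(deriv ^^ k) \<phi> x\<bar> \<le> B" for k
      using smooth_compact_support_bounded[OF test_fun_smooth[OF \<phi>], of a b k] ab(3) by metis
    then obtain B where B: "\<And>k x. \<bar>(deriv ^^ k) \<phi> x\<bar> \<le> B k" by metis
    have B0: "B k \<ge> 0" for k using B[of k 0] abs_ge_zero order_trans by blast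
    define K where "K = (\<Sum>k\<le>Suc m. B k)"
    have K: "\<bar>(deriv ^^ k) \<phi> x\<bar> \<le> K" if "k \<le> Suc m" for k x
      using B[of k x] member_le_sum[of k "{..Suc m}" B] B0 that unfolding K_def by force
    \<comment> \<open>The constant in \<open>distribution01\<close> may be negative, whereas
      \<open>good\<close> asks for \<open>0 \<le> C\<close>; enlarging it is harmless because the
      suprema are nonnegative.\<close>
    define C where "C = \<bar>C'\<bar>"
    have C: "\<bar>D \<phi>\<bar> \<le> C * (\<Sum>k\<le>m. (SUP x. \<bar>(deriv ^^ k) \<phi> x\<bar>))"
      if t: "test_fun \<phi>" "\<forall>x. x \<notin> {a / 2..(b + 1) / 2} \<longrightarrow> \<phi> x = 0" for \<phi>
    proof -
      have nn: "(SUP x. \<bar>(deriv ^^ k) \<phi> x\<bar>) \<ge> 0" for k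
      proof -
        obtain B where "\<And>x. \<bar>(deriv ^^ k) \<phi> x\<bar> \<le> B"
          using smooth_compact_support_bounded[OF test_fun_smooth[OF t(1)], of "a / 2" "(b + 1) / 2" k] t(2) by metis
        then show ?thesis by (intro cSUP_upper2[of _ _ "0::real"] bdd_aboveI2) auto
      qed
      have "\<bar>D \<phi>\<bar> \<le> C' * (\<Sum>k\<le>m. (SUP x. \<bar>(deriv ^^ k) \<phi> x\<bar>))" by (rule C'[OF t])
      also have "\<dots> \<le> C * (\<Sum>k\<le>m. (SUP x. \<bar>(deriv ^^ k) \<phi> x\<bar>))"
        unfolding C_def by (intro mult_right_mono sum_nonneg nn) auto
      finally show ?thesis .
    qed
    have r0: "r \<longlonglongrightarrow> 0" unfolding r_def using LIMSEQ_inverse_real_of_nat by (simp add: inverse_eq_divide)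
    have lims: "(\<lambda>n. 3 * r n) \<longlonglongrightarrow> 3 * 0" "(\<lambda>n. b + 3 * r n) \<longlonglongrightarrow> b + 3 * 0"
      "(\<lambda>n. real m * r n) \<longlonglongrightarrow> real m * 0" "(\<lambda>n. a - r n) \<longlonglongrightarrow> a - 0" "(\<lambda>n. b + r n) \<longlonglongrightarrow> b + 0"
      by (intro tendsto_intros r0)+
    have "\<forall>\<^sub>F n in sequentially. 3 * r n < a" "\<forall>\<^sub>F n in sequentially. b + 3 * r n < 1"
      "\<forall>\<^sub>F n in sequentially. m * r n < 1" "\<forall>\<^sub>F n in sequentially. a / 2 < a - r n"
      "\<forall>\<^sub>F n in sequentially. b + r n < (b + 1) / 2"
      using ab order_tendstoD(2)[OF lims(1), of a] order_tendstoD(2)[OF lims(2), of 1]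
        order_tendstoD(2)[OF lims(3), of 1] order_tendstoD(1)[OF lims(4), of "a / 2"]
        order_tendstoD(2)[OF lims(5), of "(b + 1) / 2"] by simp_all
    then have ev: "\<forall>\<^sub>F n in sequentially. norm (integral {0..1} (\<lambda>x. g n x * \<phi> x) - D \<phi>) \<le>
        C * (Suc m * (2 * K * r n)) + K * r n"
    proof eventually_elim
      case (elim n)
      have "good (r n) \<phi> a b C m K"
        unfolding good_def
      proof (intro conjI allI impI)
        fix \<eta> assume \<eta>: "test_fun \<eta>" "\<forall>x. x \<notin> {a - r n..b + r n} \<longrightarrow> \<eta> x = 0"
        have "{a - r n..b + r n} \<subseteq> {a / 2..(b + 1) / 2}" using elim(4,5) by simp
        then have "\<forall>x. x \<notin> {a / 2..(b + 1) / 2} \<longrightarrow> \<eta> x = 0" using \<eta>(2) by blast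
        with \<eta>(1) show "\<bar>D \<eta>\<bar> \<le> C * (\<Sum>k\<le>m. (SUP x. \<bar>(deriv ^^ k) \<eta> x\<bar>))" by (rule C)
      next
        show "\<phi> x = 0" if "x \<notin> {a..b}" for x using ab(3) that by blast
        show "\<bar>(deriv ^^ k) \<phi> x\<bar> \<le> K" if "k \<le> Suc m" for k x using that by (rule K)
      qed (use elim(1-3) \<phi> in \<open>simp_all add: C_def\<close>)
      then show ?case unfolding real_norm_def by (rule g(4))
    qed
    have "(\<lambda>n. C * (Suc m * (2 * K * r n)) + K * r n) \<longlonglongrightarrow> C * (Suc m * (2 * K * 0)) + K * 0"
      by (intro tendsto_intros r0)
    then have "(\<lambda>n. C * (Suc m * (2 * K * r n)) + K * r n) \<longlonglongrightarrow> 0" by simp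
    with ev have "(\<lambda>n. integral {0..1} (\<lambda>x. g n x * \<phi> x) - D \<phi>) \<longlonglongrightarrow> 0"
      by (rule Lim_null_comparison)
    then show "(\<lambda>n. integral {0..1} (\<lambda>x. g n x * \<phi> x)) \<longlonglongrightarrow> D \<phi>"
      by (simp add: LIM_zero_iff)
  qed
qed

section \<open>Approximation by trigonometric polynomials with the required symmetry\<close>

lemma Weierstrass_cos:
  assumes "continuous_on {0..1} g" "e > 0"
  obtains P where "real_polynomial_function P" "\<And>x. x \<in> {0..1} \<Longrightarrow> \<bar>P (cos (pi * x)) - g x\<bar> < e"
proof -
  \<comment> \<open>On [0,1] the map \<open>cos (pi * x)\<close> is a homeomorphism onto [-1,1], so
    every continuous function is a continuous function of the cosine, with no condition at the
    endpoints.\<close>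
  have "continuous_on {-1..1} (\<lambda>y. g (arccos y / pi))"
    by (rule continuous_on_compose2[OF assms(1)])
      (auto intro!: continuous_intros simp: arccos_lbound arccos_ubound)
  then obtain P where P: "real_polynomial_function P" "\<And>y. y \<in> {-1..1} \<Longrightarrow> \<bar>g (arccos y / pi) - P y\<bar> < e"
    using Stone_Weierstrass_real_polynomial_function[of "{-1..1}" "\<lambda>y. g (arccos y / pi)" e] assms(2)
    by auto
  have "\<bar>P (cos (pi * x)) - g x\<bar> < e" if "x \<in> {0..1}" for x
    using P(2)[of "cos (pi * x)"] that by (simp add: arccos_cos mult_left_le abs_minus_commute)
  with P(1) show thesis by (rule that)
qed

lemma tendsto_integral_uniform_perturbation:
  assumes lim: "(\<lambda>n. integral {0..1} (\<lambda>x. g n x * \<phi> x)) \<longlonglongrightarrow> l"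
    and g: "\<And>n. continuous_on {0..1} (g n)" and f: "\<And>n. continuous_on {0..1} (f n)"
    and \<phi>: "continuous_on {0..1} \<phi>"
    and close: "\<And>n x. x \<in> {0..1} \<Longrightarrow> \<bar>f n x - g n x\<bar> \<le> 1 / real (Suc n)"
  shows "(\<lambda>n. integral {0..1::real} (\<lambda>x. f n x * \<phi> x)) \<longlonglongrightarrow> (l::real)"
proof -
  have "bounded (\<phi> ` {0..1})"
    using \<phi> by (intro compact_imp_bounded compact_continuous_image) auto
  then obtain K where "\<forall>x\<in>{0..1}. \<bar>\<phi> x\<bar> \<le> K" by (auto simp: bounded_iff)
  then have K: "\<bar>\<phi> x\<bar> \<le> K" if "x \<in> {0..1}" for x using that by blast
  have close_int: "norm (integral {0..1} (\<lambda>x. f n x * \<phi> x) - integral {0..1} (\<lambda>x. g n x * \<phi> x)) \<le> K * (1 / real (Suc n))" for n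
  proof -
    have "integral {0..1} (\<lambda>x. f n x * \<phi> x) - integral {0..1} (\<lambda>x. g n x * \<phi> x) =
        integral {0..1} (\<lambda>x. (f n x - g n x) * \<phi> x)"
      unfolding left_diff_distrib
      by (rule Henstock_Kurzweil_Integration.integral_diff[symmetric])
        (intro integrable_continuous_interval continuous_on_mult f g \<phi>)+
    also have "norm \<dots> \<le> (1 / real (Suc n) * K) * (1 - 0)"
    proof (rule integral_bound)
      show "norm ((f n x - g n x) * \<phi> x) \<le> 1 / real (Suc n) * K" if "x \<in> {0..1}" for x
        unfolding norm_mult real_norm_def abs_mult by (intro mult_mono close K that) auto
    qed (auto intro!: continuous_intros f g \<phi>)
    finally show ?thesis by (simp add: mult.commute)
  qed
  have "(\<lambda>n. K * (1 / real (Suc n))) \<longlonglongrightarrow> K * 0"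
    using LIMSEQ_inverse_real_of_nat by (intro tendsto_intros) (simp add: inverse_eq_divide)
  then have lim0: "(\<lambda>n. K * (1 / real (Suc n))) \<longlonglongrightarrow> 0" by simp
  have "(\<lambda>n. integral {0..1} (\<lambda>x. f n x * \<phi> x) - integral {0..1} (\<lambda>x. g n x * \<phi> x)) \<longlonglongrightarrow> 0"
    by (rule Lim_null_comparison[OF always_eventually[OF allI[OF close_int]] lim0])
  from tendsto_add[OF this lim] show ?thesis by simp
qed

lemma distribution01_approx_cos:
  assumes D: "distribution01 D"
  obtains P where "\<And>n::nat. real_polynomial_function (P n)"
    "\<And>\<phi>. test_fun \<phi> \<Longrightarrow> (\<lambda>n. integral {0..1} (\<lambda>x. P n (cos (pi * x)) * \<phi> x)) \<longlonglongrightarrow> D \<phi>"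
proof -
  obtain g where g: "\<And>n::nat. continuous_on UNIV (g n)"
    "\<And>\<phi>. test_fun \<phi> \<Longrightarrow> (\<lambda>n. integral {0..1} (\<lambda>x. g n x * \<phi> x)) \<longlonglongrightarrow> D \<phi>"
    by (rule distribution01_approx_continuous[OF D]) blast
  have cg: "continuous_on A (g n)" for A n using g(1) continuous_on_subset by blast
  have "\<exists>P. real_polynomial_function P \<and> (\<forall>x\<in>{0..1}. \<bar>P (cos (pi * x)) - g n x\<bar> < 1 / real (Suc n))" for n
    by (rule Weierstrass_cos[OF cg, of "1 / real (Suc n)" n]) auto
  then obtain P where P: "\<And>n. real_polynomial_function (P n)"
    "\<And>n x. x \<in> {0..1} \<Longrightarrow> \<bar>P n (cos (pi * x)) - g n x\<bar> < 1 / real (Suc n)"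
    by metis
  show thesis
  proof (rule that[of P, OF P(1)])
    fix \<phi> assume \<phi>: "test_fun \<phi>"
    show "(\<lambda>n. integral {0..1} (\<lambda>x. P n (cos (pi * x)) * \<phi> x)) \<longlonglongrightarrow> D \<phi>"
    proof (rule tendsto_integral_uniform_perturbation[OF g(2)[OF \<phi>] cg])
      show "continuous_on {0..1} (\<lambda>x. P n (cos (pi * x)))" for n
        using P(1) by (intro continuous_on_compose2[OF continuous_on_polymonial_function[of "P n" UNIV]]
            continuous_intros) (auto simp: real_polynomial_function_eq)
      show "continuous_on {0..1} \<phi>"
        using smooth_on_continuous_higher_deriv[OF test_fun_smooth[OF \<phi>], of _ 0] by simp
    qed (use P(2) less_imp_le in blast)
  qed
qed

text \<open>The factor \<open>sin (pi * x)\<close> supplies oddness about 0 and 1. It is divided out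
  of \<open>g n\<close> before Weierstrass is applied and multiplied back afterwards, which does not
  increase the error.\<close>

lemma distribution01_approx_sin:
  assumes D: "distribution01 D"
  obtains P where "\<And>n::nat. real_polynomial_function (P n)"
    "\<And>\<phi>. test_fun \<phi> \<Longrightarrow> (\<lambda>n. integral {0..1} (\<lambda>x. sin (pi * x) * P n (cos (pi * x)) * \<phi> x)) \<longlonglongrightarrow> D \<phi>"
proof -
  obtain g \<delta> where g: "\<And>n::nat. continuous_on UNIV (g n)" "\<And>n. \<delta> n > 0"
    "\<And>n x. x \<notin> {\<delta> n..1 - \<delta> n} \<Longrightarrow> g n x = 0"
    "\<And>\<phi>. test_fun \<phi> \<Longrightarrow> (\<lambda>n. integral {0..1} (\<lambda>x. g n x * \<phi> x)) \<longlonglongrightarrow> D \<phi>"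
    by (rule distribution01_approx_continuous[OF D]) blast
  have cg: "continuous_on A (g n)" for A n using g(1) continuous_on_subset by blast
  have "\<exists>P. real_polynomial_function P \<and>
    (\<forall>x\<in>{0..1}. \<bar>sin (pi * x) * P (cos (pi * x)) - g n x\<bar> \<le> 1 / real (Suc n))" for n
  proof -
    \<comment> \<open>The quotient is continuous on (0,1), where the sine is positive, and zero near
      the endpoints, where the sine vanishes; the two open sets overlap and cover [0,1].\<close>
    define h where "h x = (if x \<in> {\<delta> n..1 - \<delta> n} then g n x / sin (pi * x) else 0)" for x
    have sin: "sin (pi * x) > 0" if "0 < x" "x < 1" for x using that by (intro sin_gt_zero) auto
    have h: "h x = g n x / sin (pi * x)" for x using g(3)[of x n] by (simp add: h_def)
    have "continuous_on ({0<..<1} \<union> ({..<\<delta> n} \<union> {1 - \<delta> n<..})) h"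
    proof (rule continuous_on_open_Un)
      show "continuous_on {0<..<1} h"
        unfolding h by (intro continuous_intros cg) (use sin in force)
      show "continuous_on ({..<\<delta> n} \<union> {1 - \<delta> n<..}) h"
        by (rule continuous_on_eq[of _ "\<lambda>x. 0"]) (auto simp: h_def)
    qed auto
    then have "continuous_on {0..1} h"
      by (rule continuous_on_subset) (use g(2)[of n] in auto)
    then obtain P where P: "real_polynomial_function P"
      "\<And>x. x \<in> {0..1} \<Longrightarrow> \<bar>P (cos (pi * x)) - h x\<bar> < 1 / real (Suc n)"
      by (rule Weierstrass_cos[of h "1 / real (Suc n)"]) auto
    have "\<bar>sin (pi * x) * P (cos (pi * x)) - g n x\<bar> \<le> 1 / real (Suc n)" if x: "x \<in> {0..1}" for x
    proof -
      have "g n x = sin (pi * x) * h x"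
      proof (cases "x \<in> {\<delta> n..1 - \<delta> n}")
        case True
        then show ?thesis using sin[of x] g(2)[of n] by (simp add: h)
      next
        case False
        then show ?thesis using g(3)[OF False] by (simp only: h_def if_False mult_zero_right)
      qed
      then have "\<bar>sin (pi * x) * P (cos (pi * x)) - g n x\<bar> = \<bar>sin (pi * x)\<bar> * \<bar>P (cos (pi * x)) - h x\<bar>"
        by (simp add: abs_mult[symmetric] right_diff_distrib)
      also have "\<dots> \<le> 1 * (1 / real (Suc n))"
        using P(2)[OF x] by (intro mult_mono abs_sin_le_one) auto
      finally show ?thesis by simp
    qed
    with P(1) show ?thesis by blast
  qed
  then obtain P where P: "\<And>n. real_polynomial_function (P n)"
    "\<And>n x. x \<in> {0..1} \<Longrightarrow> \<bar>sin (pi * x) * P n (cos (pi * x)) - g n x\<bar> \<le> 1 / real (Suc n)"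
    by metis
  show thesis
  proof (rule that[of P, OF P(1)])
    fix \<phi> assume \<phi>: "test_fun \<phi>"
    show "(\<lambda>n. integral {0..1} (\<lambda>x. sin (pi * x) * P n (cos (pi * x)) * \<phi> x)) \<longlonglongrightarrow> D \<phi>"
    proof (rule tendsto_integral_uniform_perturbation[OF g(4)[OF \<phi>] cg])
      show "continuous_on {0..1} (\<lambda>x. sin (pi * x) * P n (cos (pi * x)))" for n
        using P(1) by (intro continuous_intros
            continuous_on_compose2[OF continuous_on_polymonial_function[of "P n" UNIV]])
            (auto simp: real_polynomial_function_eq)
      show "continuous_on {0..1} \<phi>"
        using smooth_on_continuous_higher_deriv[OF test_fun_smooth[OF \<phi>], of _ 0] by simp
    qed (use P(2) in blast)
  qed
qed

section \<open>The wave equation with a bounded potential\<close>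

text \<open>The oriented integral from 0 to \<open>t\<close>, rescaled to [0,1]. Negative
  \<open>t\<close> needs no case distinction, and with a fixed domain of integration the theorems on
  parameter integrals apply directly.\<close>

definition primitive :: "(real \<Rightarrow> real) \<Rightarrow> real \<Rightarrow> real" where
  "primitive f t = t * integral {0..1} (\<lambda>s. f (t * s))"

lemma primitive_eqI:
  assumes F: "\<And>s. s \<in> closed_segment 0 t \<Longrightarrow> (F has_real_derivative f s) (at s within closed_segment 0 t)"
  shows "primitive f t = F t - F 0"
proof -
  have seg: "(\<lambda>s. t * s) ` {0..1} \<subseteq> closed_segment 0 t"
    by (auto simp: in_segment)
  have "((\<lambda>s. t * f (t * s)) has_integral F (t * 1) - F (t * 0)) {0..1}"
  proof (rule fundamental_theorem_of_calculus[of 0 1 "\<lambda>s. F (t * s)"])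
    fix s :: real assume s: "s \<in> {0..1}"
    have "((\<lambda>s. F (t * s)) has_real_derivative f (t * s) * t) (at s within {0..1})"
      using DERIV_image_chain[of F "f (t * s)" "\<lambda>s. t * s" s "{0..1}" t]
        has_field_derivative_subset[OF F[of "t * s"] seg] seg s
      by (force intro!: derivative_eq_intros simp: o_def)
    then show "((\<lambda>s. F (t * s)) has_vector_derivative t * f (t * s)) (at s within {0..1})"
      by (simp add: has_real_derivative_iff_has_vector_derivative mult.commute)
  qed simp
  from integral_unique[OF this] show ?thesis by (simp add: primitive_def)
qed

lemma primitive_0 [simp]: "primitive f 0 = 0"
  by (simp add: primitive_def)

lemma DERIV_primitive:
  assumes "continuous_on UNIV f"
  shows "(primitive f has_real_derivative f t) (at t)"
proof -
  \<comment> \<open>Puts both 0 and \<open>t\<close> in the interior of the window, so that the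
    derivative of the ordinary integral within \<open>{-R..R}\<close> is two-sided at
    \<open>t\<close>.\<close>
  define R where "R = \<bar>t\<bar> + 1"
  define F where "F s = integral {-R..s} f" for s
  have F: "(F has_real_derivative f s) (at s within {-R..R})" if "s \<in> {-R..R}" for s
    unfolding F_def using that assms
    by (intro integral_has_real_derivative) (auto intro: continuous_on_subset)
  have eq: "primitive f s = F s - F 0" if "s \<in> {-R<..<R}" for s
  proof (rule primitive_eqI)
    have sub: "closed_segment 0 s \<subseteq> {-R..R}" using that by (auto simp: closed_segment_eq_real_ivl)
    fix x assume "x \<in> closed_segment 0 s"
    then show "(F has_real_derivative f x) (at x within closed_segment 0 s)"
      using F sub by (blast intro: has_field_derivative_subset)
  qed
  have t: "t \<in> {-R<..<R}" by (auto simp: R_def)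
  have "(F has_real_derivative f t) (at t)"
    using F[of t] t at_within_interior[of t "{-R..R}"] by (simp add: interior_atLeastAtMost_real)
  then have "((\<lambda>s. F s - F 0) has_real_derivative f t) (at t)"
    by (auto intro!: derivative_eq_intros)
  then show ?thesis
    by (rule has_field_derivative_transform_within_open[where S = "{-R<..<R}"]) (use t eq in auto)
qed

lemma has_integral_primitive:
  assumes "continuous_on UNIV f" "a \<le> b"
  shows "(f has_integral primitive f b - primitive f a) {a..b}"
  using assms(2)
  by (rule fundamental_theorem_of_calculus)
    (simp add: has_field_derivative_at_within DERIV_primitive[OF assms(1)]
      flip: has_real_derivative_iff_has_vector_derivative)

lemma continuous_on_primitive:
  fixes f :: "'a::topological_space \<Rightarrow> real \<Rightarrow> real"
  assumes f: "continuous_on UNIV (\<lambda>(p, s). f p s)" and b: "continuous_on UNIV b"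
  shows "continuous_on UNIV (\<lambda>p. primitive (f p) (b p))"
proof -
  have "continuous_on (UNIV \<times> cbox 0 1) (\<lambda>(p, s). f p (b p * s))"
    unfolding split_beta
    by (rule continuous_on_compose2[OF f[unfolded split_beta], where f = "\<lambda>x. (fst x, b (fst x) * snd x)", simplified])
      (auto intro!: continuous_intros continuous_on_compose2[OF b])
  then have "continuous_on UNIV (\<lambda>p. integral (cbox 0 1) (\<lambda>s. f p (b p * s)))"
    by (rule integral_continuous_on_param)
  then show ?thesis unfolding primitive_def using b by (auto intro!: continuous_intros)
qed

lemma primitive_diff:
  assumes "continuous_on UNIV f" "continuous_on UNIV g"
  shows "primitive (\<lambda>s. f s - g s) t = primitive f t - primitive g t"
proof -
  have "primitive (\<lambda>s. f s - g s) t = (primitive f t - primitive g t) - (primitive f 0 - primitive g 0)"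
    by (rule primitive_eqI[where F = "\<lambda>t. primitive f t - primitive g t"])
      (intro DERIV_diff DERIV_primitive[THEN has_field_derivative_at_within] assms)
  then show ?thesis by simp
qed

text \<open>The solution of the transport equation w_t - c w_x = h with zero initial value, by
  integration along characteristics.\<close>

definition transport :: "real \<Rightarrow> (real \<Rightarrow> real \<Rightarrow> real) \<Rightarrow> real \<Rightarrow> real \<Rightarrow> real" where
  "transport c h t x = primitive (\<lambda>s. h s (x + c * (t - s))) t"

lemma continuous_on_compose_pair:
  assumes "continuous_on UNIV (\<lambda>(t, x). h t x)" "continuous_on S a" "continuous_on S b"
  shows "continuous_on S (\<lambda>p. h (a p) (b p))"
  using continuous_on_compose2[OF assms(1) continuous_on_Pair[OF assms(2,3)]] by simp

lemma continuous_on_transport: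
  assumes "continuous_on UNIV (\<lambda>(t, x). h t x)"
  shows "continuous_on UNIV (\<lambda>(t, x). transport c h t x)"
  unfolding transport_def split_beta
  by (rule continuous_on_primitive)
    (auto simp: split_beta intro!: continuous_on_compose_pair[OF assms] continuous_intros)

lemma transport_deriv_x:
  assumes h: "continuous_on UNIV (\<lambda>(t, x). h t x)" and h': "continuous_on UNIV (\<lambda>(t, x). h' t x)"
    and d: "\<And>t x. (h t has_real_derivative h' t x) (at x)"
  shows "(transport c h t has_real_derivative transport c h' t x) (at x)"
proof -
  have "((\<lambda>x. integral (cbox 0 1) (\<lambda>s. h (t * s) (x + c * (t - t * s)))) has_real_derivative
      integral (cbox 0 1) (\<lambda>s. h' (t * s) (x + c * (t - t * s)))) (at x within UNIV)"
  proof (rule leibniz_rule_field_derivative)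
    show "((\<lambda>x. h (t * s) (x + c * (t - t * s))) has_real_derivative h' (t * s) (x + c * (t - t * s)))
        (at x within UNIV)" for x s
    proof -
      have "((\<lambda>x. x + c * (t - t * s)) has_real_derivative 1) (at x)"
        by (auto intro!: derivative_eq_intros)
      from DERIV_chain2[OF d[of "t * s"] this] show ?thesis by simp
    qed
    show "(\<lambda>s. h (t * s) (x + c * (t - t * s))) integrable_on cbox 0 1" for x
      by (intro integrable_continuous continuous_on_compose_pair[OF h] continuous_intros)
    show "continuous_on (UNIV \<times> cbox 0 1) (\<lambda>(x, s). h' (t * s) (x + c * (t - t * s)))"
      unfolding split_beta by (intro continuous_on_compose_pair[OF h'] continuous_intros)
  qed auto
  then show ?thesis
    unfolding transport_def[abs_def] primitive_def using DERIV_cmult[of _ _ x UNIV t] by simp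
qed

text \<open>Time enters both as the endpoint and inside the integrand. Labelling the characteristic
  by \<open>z = x + c * t\<close> separates the two roles; the chain rule then adds the endpoint
  term and \<open>c\<close> times the derivative in \<open>z\<close>.\<close>

lemma transport_deriv_t:
  assumes h: "continuous_on UNIV (\<lambda>(t, x). h t x)" and h': "continuous_on UNIV (\<lambda>(t, x). h' t x)"
    and d: "\<And>t x. (h t has_real_derivative h' t x) (at x)"
  shows "((\<lambda>t. transport c h t x) has_real_derivative h t x + c * transport c h' t x) (at t)"
proof -
  \<comment> \<open>along a characteristic: \<open>z\<close> is the foot of the line \<open>x + c t\<close>\<close>
  define B where "B k t z = primitive (\<lambda>s. k s (z - c * s)) t" for k :: "real \<Rightarrow> real \<Rightarrow> real" and t z
  have B: "transport c k t x = B k t (x + c * t)" for k t x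
    by (simp add: transport_def B_def algebra_simps)
  have B_t: "((\<lambda>t. B h t z) has_real_derivative h t (z - c * t)) (at t)" for t z
    unfolding B_def
    by (rule DERIV_primitive) (intro continuous_on_compose_pair[OF h] continuous_intros)
  have B_z: "((\<lambda>z. B h t z) has_real_derivative B h' t z) (at z)" for t z
  proof -
    have "((\<lambda>y. transport c h t (y - c * t)) has_real_derivative transport c h' t (z - c * t) * 1) (at z)"
      by (rule DERIV_chain2[OF transport_deriv_x[OF h h' d]]) (auto intro!: derivative_eq_intros)
    then show ?thesis by (simp add: B)
  qed
  have B_cont: "continuous_on UNIV (\<lambda>p. B h' (fst p) (snd p))"
    unfolding B_def
    by (rule continuous_on_primitive)
      (auto simp: split_beta intro!: continuous_on_compose_pair[OF h'] continuous_intros)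
  \<comment> \<open>Total differentiability follows from the existence of the partial derivative in
    \<open>t\<close> and the joint continuity of the one in \<open>z\<close>;
    \<open>blinfun_mult_right\<close> presents the latter as a bounded operator.\<close>
  have "((\<lambda>(t, z). B h t z) has_derivative
      (\<lambda>(dt, dz). h t ((x + c * t) - c * t) * dt + blinfun_mult_right (B h' t (x + c * t)) dz))
      (at (t, x + c * t) within UNIV \<times> UNIV)"
  proof (rule has_derivative_partialsI[where fy = "\<lambda>t z. blinfun_mult_right (B h' t z)"])
    show "((\<lambda>t. B h t (x + c * t')) has_derivative (*) (h t (x + c * t' - c * t))) (at t within UNIV)" for t t'
      using B_t by (simp add: has_field_derivative_def)
    show "(B h t has_derivative blinfun_apply (blinfun_mult_right (B h' t z))) (at z within UNIV)" for t z
      using B_z by (simp add: has_field_derivative_def)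
    have "continuous_on UNIV (\<lambda>p. blinfun_mult_right (B h' (fst p) (snd p)))"
      by (rule bounded_linear.continuous_on[OF bounded_linear_blinfun_mult_right B_cont])
    then have "isCont (\<lambda>p. blinfun_mult_right (B h' (fst p) (snd p))) (t, x + c * t)"
      by (simp only: continuous_on_eq_continuous_at[OF open_UNIV] UNIV_I ball_UNIV)
    then show "continuous (at (t, x + c * t) within UNIV \<times> UNIV) (\<lambda>(t, z). blinfun_mult_right (B h' t z))"
      by (simp add: case_prod_unfold)
  qed auto
  then have "((\<lambda>(t, z). B h t z) has_derivative
      (\<lambda>(dt, dz). h t x * dt + B h' t (x + c * t) * dz)) (at ((\<lambda>t. (t, x + c * t)) t))"
    by simp
  moreover have "((\<lambda>t. (t, x + c * t)) has_derivative (\<lambda>dt. (dt, c * dt))) (at t)"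
    by (auto intro!: derivative_eq_intros)
  ultimately have "((\<lambda>t. (\<lambda>(t, z). B h t z) (t, x + c * t)) has_derivative
      (\<lambda>dt. (\<lambda>(dt, dz). h t x * dt + B h' t (x + c * t) * dz) (dt, c * dt))) (at t)"
    by (rule has_derivative_compose[rotated])
  moreover have "(\<lambda>dt. (\<lambda>(dt, dz). h t x * dt + B h' t (x + c * t) * dz) (dt, c * dt)) =
      (*) (h t x + c * B h' t (x + c * t))"
    by (auto simp: fun_eq_iff algebra_simps)
  ultimately show ?thesis by (simp add: B has_field_derivative_def)
qed

text \<open>\<open>duhamel g / 2\<close> solves the wave equation with right-hand side \<open>g\<close> and zero initial data;
  the integral over the backward light cone is split into two transport integrals.\<close>
definition duhamel :: "(real \<Rightarrow> real \<Rightarrow> real) \<Rightarrow> real \<Rightarrow> real \<Rightarrow> real" where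
  "duhamel g t x = transport 1 (\<lambda>s. primitive (g s)) t x - transport (-1) (\<lambda>s. primitive (g s)) t x"

context
  fixes g :: "real \<Rightarrow> real \<Rightarrow> real"
  assumes g: "continuous_on UNIV (\<lambda>(t, x). g t x)"
begin

lemma continuous_on_section: "continuous_on UNIV (g s)"
  using continuous_on_compose_pair[OF g, of UNIV "\<lambda>_. s" "\<lambda>x. x"] by (simp add: continuous_intros)

lemma continuous_on_primitive_sections: "continuous_on UNIV (\<lambda>(t, x). primitive (g t) x)"
  unfolding split_beta
  by (rule continuous_on_primitive)
    (auto simp: split_beta intro!: continuous_on_compose_pair[OF g] continuous_intros)

lemma continuous_on_duhamel: "continuous_on UNIV (\<lambda>(t, x). duhamel g t x)"
  using continuous_on_diff[OF continuous_on_transport[OF continuous_on_primitive_sections, of 1]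
      continuous_on_transport[OF continuous_on_primitive_sections, of "-1"]]
  by (simp add: duhamel_def split_beta)

text \<open>The derivative falls on the inner primitive and returns \<open>g\<close> itself, so
  continuity of \<open>g\<close> suffices. This gain of one derivative drives the regularity
  argument for the fixed point.\<close>

lemma duhamel_deriv_x:
  "(duhamel g t has_real_derivative transport 1 g t x - transport (-1) g t x) (at x)"
  unfolding duhamel_def[abs_def]
  by (intro DERIV_diff transport_deriv_x continuous_on_primitive_sections g
      DERIV_primitive continuous_on_section)

lemma duhamel_deriv_t:
  "((\<lambda>t. duhamel g t x) has_real_derivative transport 1 g t x + transport (-1) g t x) (at t)"
  unfolding duhamel_def
  \<comment> \<open>The endpoint terms \<open>primitive (g t) x\<close> of the two transports
    cancel, while the opposite speeds turn the difference into a sum.\<close>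
  using DERIV_diff[OF
      transport_deriv_t[OF continuous_on_primitive_sections g DERIV_primitive[OF continuous_on_section], of 1 x t]
      transport_deriv_t[OF continuous_on_primitive_sections g DERIV_primitive[OF continuous_on_section], of "-1" x t]]
  by simp

lemma duhamel_cone:
  assumes "t \<ge> 0"
  shows "duhamel g t x = integral {0..t} (\<lambda>s. integral {x - (t - s)..x + (t - s)} (g s))"
proof -
  have c: "continuous_on UNIV (\<lambda>s. primitive (g s) (x + c * (t - s)))" for c
    by (intro continuous_on_compose_pair[OF continuous_on_primitive_sections] continuous_intros)
  have i: "((\<lambda>s. primitive (g s) (x + c * (t - s))) has_integral transport c (\<lambda>s. primitive (g s)) t x) {0..t}" for c
    using has_integral_primitive[OF c assms] by (simp add: transport_def)
  have "((\<lambda>s. integral {x - (t - s)..x + (t - s)} (g s)) has_integral duhamel g t x) {0..t}"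
    unfolding duhamel_def
  proof (rule has_integral_eq[OF _ has_integral_diff[OF i i]])
    fix s assume "s \<in> {0..t}"
    then have "(g s has_integral primitive (g s) (x + (t - s)) - primitive (g s) (x - (t - s)))
        {x - (t - s)..x + (t - s)}"
      by (intro has_integral_primitive continuous_on_section) auto
    from integral_unique[OF this]
    show "primitive (g s) (x + 1 * (t - s)) - primitive (g s) (x + - 1 * (t - s)) =
        integral {x - (t - s)..x + (t - s)} (g s)"
      by (simp only: mult_minus_left mult_1 add_uminus_conv_diff)
  qed
  then show ?thesis by (simp add: integral_unique)
qed

text \<open>On the cone each slice has length at most \<open>2 * T\<close>, and integrating the
  weight \<open>exp (L * s)\<close> in time gains the factor \<open>1 / L\<close>. A large
  \<open>L\<close> therefore makes the operator small in the weighted norm, however long the time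
  interval.\<close>

lemma duhamel_bound:
  assumes t: "0 \<le> t" "t \<le> T" and L: "L > 0"
    and K: "\<And>s y. 0 \<le> s \<Longrightarrow> s \<le> t \<Longrightarrow> \<bar>g s y\<bar> \<le> K * exp (L * s)"
  shows "\<bar>duhamel g t x\<bar> \<le> 2 * T * K / L * exp (L * t)"
proof -
  have "\<bar>g 0 0\<bar> \<le> K" using K[of 0 0] t by simp
  then have K0: "K \<ge> 0" by linarith
  have c: "continuous_on UNIV (\<lambda>s. primitive (g s) (x + (t - s)) - primitive (g s) (x - (t - s)))"
    by (intro continuous_on_compose_pair[OF continuous_on_primitive_sections] continuous_intros)
  have eq: "integral {x - (t - s)..x + (t - s)} (g s) =
      primitive (g s) (x + (t - s)) - primitive (g s) (x - (t - s))" if "s \<in> {0..t}" for s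
    using that by (intro integral_unique has_integral_primitive continuous_on_section) auto
  have 1: "((\<lambda>s. 2 * T * K * exp (L * s)) has_integral
      2 * T * K / L * exp (L * t) - 2 * T * K / L * exp (L * 0)) {0..t}"
    by (rule fundamental_theorem_of_calculus[of 0 t "\<lambda>s. 2 * T * K / L * exp (L * s)"])
      (use t L in \<open>auto intro!: derivative_eq_intros
        simp flip: has_real_derivative_iff_has_vector_derivative\<close>)
  have "norm (integral {0..t} (\<lambda>s. integral {x - (t - s)..x + (t - s)} (g s))) \<le>
      integral {0..t} (\<lambda>s. 2 * T * K * exp (L * s))"
  proof (rule integral_norm_bound_integral)
    have "(\<lambda>s. primitive (g s) (x + (t - s)) - primitive (g s) (x - (t - s))) integrable_on {0..t}"
      by (intro integrable_continuous_interval continuous_on_subset[OF c]) simp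
    then show "(\<lambda>s. integral {x - (t - s)..x + (t - s)} (g s)) integrable_on {0..t}"
      by (rule integrable_eq) (simp add: eq)
    show "(\<lambda>s. 2 * T * K * exp (L * s)) integrable_on {0..t}" using 1 by blast
    fix s assume s: "s \<in> {0..t}"
    have "norm (integral {x - (t - s)..x + (t - s)} (g s)) \<le> K * exp (L * s) * ((x + (t - s)) - (x - (t - s)))"
      by (rule integral_bound) (use s K continuous_on_subset[OF continuous_on_section] in auto)
    also have "\<dots> \<le> K * exp (L * s) * (2 * T)"
      using K0 s t by (intro mult_left_mono) auto
    finally show "norm (integral {x - (t - s)..x + (t - s)} (g s)) \<le> 2 * T * K * exp (L * s)"
      by (simp add: mult_ac)
  qed
  also have "\<dots> = 2 * T * K / L * exp (L * t) - 2 * T * K / L * exp (L * 0)"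
    by (rule integral_unique[OF 1])
  also have "\<dots> \<le> 2 * T * K / L * exp (L * t)" using t K0 L by simp
  finally show ?thesis using t by (simp add: duhamel_cone)
qed

text \<open>If \<open>g\<close> is odd about \<open>a\<close>, its primitive is even about
  \<open>a\<close>. Reflection then interchanges the transports of speed 1 and -1, and their
  difference changes sign.\<close>

lemma duhamel_reflect:
  assumes odd: "\<And>s y. g s (2 * a - y) = - g s y"
  shows "duhamel g t (2 * a - x) = - duhamel g t x"
proof -
  have P: "primitive (g s) (2 * a - y) = primitive (g s) y" for s y
  proof -
    have d: "((\<lambda>y. primitive (g s) (2 * a - y) - primitive (g s) y) has_real_derivative 0) (at y)" for y
      by (rule derivative_eq_intros DERIV_chain2[OF DERIV_primitive[OF continuous_on_section]]
          DERIV_primitive[OF continuous_on_section] | simp add: odd)+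
    have "primitive (g s) (2 * a - y) - primitive (g s) y = primitive (g s) (2 * a - a) - primitive (g s) a"
      using DERIV_isconst_all[of "\<lambda>y. primitive (g s) (2 * a - y) - primitive (g s) y" y a] d by blast
    then show ?thesis by simp
  qed
  have "transport c (\<lambda>s. primitive (g s)) t (2 * a - x) = transport (- c) (\<lambda>s. primitive (g s)) t x" for c
  proof -
    have "primitive (g s) (2 * a - x + c * (t - s)) = primitive (g s) (x + - c * (t - s))" for s
      using P[of s "x + - c * (t - s)"] by (simp add: algebra_simps)
    then show ?thesis by (simp add: transport_def)
  qed
  from this[of 1] this[of "-1"] show ?thesis by (simp add: duhamel_def)
qed

end

section \<open>Contraction argument and classical solutions\<close>

lemma transport_diff:
  assumes "continuous_on UNIV (\<lambda>(t, x). h t x)" "continuous_on UNIV (\<lambda>(t, x). k t x)"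
  shows "transport c (\<lambda>t x. h t x - k t x) t x = transport c h t x - transport c k t x"
  unfolding transport_def
  by (rule primitive_diff; intro continuous_on_compose_pair[OF assms(1)]
      continuous_on_compose_pair[OF assms(2)] continuous_intros)

lemma duhamel_diff:
  assumes "continuous_on UNIV (\<lambda>(t, x). h t x)" "continuous_on UNIV (\<lambda>(t, x). k t x)"
  shows "duhamel (\<lambda>t x. h t x - k t x) t x = duhamel h t x - duhamel k t x"
proof -
  have "(\<lambda>s. primitive (\<lambda>x. h s x - k s x)) = (\<lambda>s y. primitive (h s) y - primitive (k s) y)"
    using assms by (intro ext primitive_diff continuous_on_section)
  then show ?thesis
    by (simp add: duhamel_def transport_diff[OF continuous_on_primitive_sections[OF assms(1)]
          continuous_on_primitive_sections[OF assms(2)]])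
qed

lemma continuous_on_eval_bcontfun:
  fixes p :: "'a::topological_space"
  shows "continuous_on UNIV (\<lambda>v :: 'a \<Rightarrow>\<^sub>C real. apply_bcontfun v p)"
  unfolding continuous_on_iff using dist_fun_lt_imp_dist_val_lt by blast

text \<open>Picard iteration in the weighted space \<open>v(t,x) = exp (- L t) w(t,x)\<close>, where the Duhamel operator
  is a contraction on all of \<open>[0,T]\<close> for large \<open>L\<close>. Times outside \<open>[0,T]\<close> are clamped so that
  \<open>v\<close> lives on the whole plane; odd symmetry about 0 and 1 encodes the Dirichlet conditions.\<close>
lemma duhamel_fixed_point:
  fixes h :: "real \<Rightarrow> real \<Rightarrow> real" and q :: "real \<Rightarrow> real"
  assumes T: "T > 0" and h: "continuous_on UNIV (\<lambda>(t, x). h t x)" and q: "continuous_on UNIV q"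
    and H: "\<And>t x. 0 \<le> t \<Longrightarrow> t \<le> T \<Longrightarrow> \<bar>h t x\<bar> \<le> H" and M: "\<And>x. \<bar>q x\<bar> \<le> M"
    and odd: "\<And>t x a. a \<in> {0, 1} \<Longrightarrow> h t (2 * a - x) = - h t x" "\<And>x a. a \<in> {0, 1} \<Longrightarrow> q (2 * a - x) = q x"
  obtains w where "continuous_on UNIV (\<lambda>(t, x). w t x)"
    "\<And>t x. w t x = duhamel (\<lambda>s y. h s y - q y * w s y) (max 0 (min T t)) x / 2"
    "\<And>t x a. a \<in> {0, 1} \<Longrightarrow> w t (2 * a - x) = - w t x"
proof -
  have M0: "M \<ge> 0" using M[of 0] by linarith
  have H0: "H \<ge> 0" using H[of 0 0] T by linarith
  \<comment> \<open>The contraction constant will be \<open>T * M / L\<close>, hence at most 1/4;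
    the summand 1 keeps \<open>L\<close> positive when \<open>M = 0\<close>.\<close>
  define L where "L = 4 * T * M + 1"
  have L: "L > 0" using T M0 by (simp add: L_def add_nonneg_pos)
  define c where "c t = max 0 (min T t)" for t
  have c: "0 \<le> c t" "c t \<le> T" for t using T by (auto simp: c_def)
  have c_id: "c t = t" if "0 \<le> t" "t \<le> T" for t using that by (auto simp: c_def)
  have cc: "continuous_on A c" for A unfolding c_def by (intro continuous_intros)
  have cq: "continuous_on A (\<lambda>p. q (snd p))" for A :: "(real \<times> real) set"
    by (rule continuous_on_compose2[OF q]) (auto intro!: continuous_intros)
  define g where "g v s y = h s y - q y * (exp (L * c s) * apply_bcontfun v (s, y))"
    for v :: "(real \<times> real) \<Rightarrow>\<^sub>C real" and s y
  have g: "continuous_on UNIV (\<lambda>(t, x). g v t x)" for v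
  proof -
    have "continuous_on UNIV (\<lambda>p. h (fst p) (snd p) - q (snd p) * (exp (L * c (fst p)) * apply_bcontfun v p))"
      by (intro continuous_intros continuous_on_compose_pair[OF h] cq continuous_on_compose2[OF cc] continuous_on_apply_bcontfun) auto
    then show ?thesis by (simp add: g_def case_prod_unfold)
  qed
  define \<Phi> where "\<Phi> v = (\<lambda>(t, x). exp (- L * c t) * (duhamel (g v) (c t) x / 2))" for v
  \<comment> \<open>Used twice: with \<open>k = g v\<close> it shows that \<open>\<Phi> v\<close> is
    bounded, with a difference \<open>g v - g v'\<close> that \<open>\<Phi>\<close>
    contracts.\<close>
  have bound: "\<bar>exp (- L * c t) * (duhamel k (c t) x / 2)\<bar> \<le> T * K / L"
    if k: "continuous_on UNIV (\<lambda>(t, x). k t x)"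
      and kb: "\<And>s y. 0 \<le> s \<Longrightarrow> s \<le> T \<Longrightarrow> \<bar>k s y\<bar> \<le> K * exp (L * s)" for k K t x
  proof -
    have "\<bar>duhamel k (c t) x\<bar> \<le> 2 * T * K / L * exp (L * c t)"
      using c[of t] by (intro duhamel_bound[OF k] L kb) auto
    then have "\<bar>duhamel k (c t) x\<bar> * exp (- L * c t) \<le> 2 * T * K / L * exp (L * c t) * exp (- L * c t)"
      by (intro mult_right_mono) auto
    also have "\<dots> = 2 * T * K / L" by (simp add: exp_add[symmetric] mult.assoc)
    finally show ?thesis by (simp add: abs_mult mult.commute)
  qed
  have \<Phi>: "\<Phi> v \<in> bcontfun" for v
    unfolding bcontfun_def
  proof (intro CollectI conjI)
    show "continuous_on UNIV (\<Phi> v)"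
      unfolding \<Phi>_def split_beta
      by (intro continuous_intros continuous_on_compose_pair[OF continuous_on_duhamel[OF g]]
          continuous_on_compose2[OF cc]) auto
    obtain V where V: "\<And>p. \<bar>apply_bcontfun v p\<bar> \<le> V"
      using bounded_apply_bcontfun[of v] by (auto simp: bounded_iff)
    have "\<bar>g v s y\<bar> \<le> (H + M * V) * exp (L * s)" if s: "0 \<le> s" "s \<le> T" for s y
    proof -
      have "1 \<le> exp (L * s)" using s L by simp
      then have 1: "H * 1 \<le> H * exp (L * s)" using H0 by (rule mult_left_mono)
      have 2: "\<bar>q y * (exp (L * s) * apply_bcontfun v (s, y))\<bar> \<le> M * (exp (L * s) * V)"
        unfolding abs_mult using M V M0 by (intro mult_mono) auto
      have "\<bar>g v s y\<bar> \<le> \<bar>h s y\<bar> + \<bar>q y * (exp (L * s) * apply_bcontfun v (s, y))\<bar>"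
        unfolding g_def c_id[OF s] by (rule abs_triangle_ineq4)
      also have "\<dots> \<le> H * exp (L * s) + M * (exp (L * s) * V)" using 1 2 H[OF s, of y] by linarith
      finally show ?thesis by (simp add: algebra_simps)
    qed
    from bound[OF g this] have "norm (\<Phi> v p) \<le> T * (H + M * V) / L" for p
      by (simp add: \<Phi>_def case_prod_unfold)
    then show "bounded (range (\<Phi> v))" by (auto simp: bounded_iff)
  qed
  \<comment> \<open>Oddness is built into the space: point evaluations are continuous, so
    \<open>X\<close> is closed and thus complete, and the iteration preserves it. The fixed point
    inherits the symmetry.\<close>
  define X where "X = {v :: (real \<times> real) \<Rightarrow>\<^sub>C real. \<forall>t x. \<forall>a\<in>{0, 1}.
    apply_bcontfun v (t, 2 * a - x) = - apply_bcontfun v (t, x)}"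
  have "X = (\<Inter>t. \<Inter>x. \<Inter>a\<in>{0, 1}. {v. apply_bcontfun v (t, 2 * a - x) = - apply_bcontfun v (t, x)})"
    by (auto simp: X_def)
  then have "closed X"
    by (auto intro!: closed_INT closed_Collect_eq continuous_on_minus continuous_on_eval_bcontfun)
  then have complete: "complete X" by (simp add: complete_eq_closed)
  have "const_bcontfun 0 \<in> X" by (simp add: X_def const_bcontfun.rep_eq)
  then have nonempty: "X \<noteq> {}" by blast
  have "\<exists>!v\<in>X. Bcontfun (\<Phi> v) = v"
  proof (rule Banach_fix[OF complete nonempty, of "1/4"])
    show "(\<lambda>v. Bcontfun (\<Phi> v)) ` X \<subseteq> X"
    proof (intro image_subsetI)
      fix v assume v: "v \<in> X"
      have reflect: "duhamel (g v) t (2 * a - x) = - duhamel (g v) t x" if a: "a \<in> {0, 1}" for a t x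
      proof (rule duhamel_reflect[OF g])
        have "apply_bcontfun v (s, 2 * a - y) = - apply_bcontfun v (s, y)" for s y
          using v a unfolding X_def by blast
        then show "g v s (2 * a - y) = - g v s y" for s y
          unfolding g_def using odd(1)[OF a] odd(2)[OF a] by (simp add: algebra_simps)
      qed
      have "\<Phi> v (t, 2 * a - x) = - \<Phi> v (t, x)" if "a \<in> {0, 1}" for a t x
        by (simp add: \<Phi>_def reflect[OF that])
      then show "Bcontfun (\<Phi> v) \<in> X"
        unfolding X_def by (intro CollectI allI ballI) (simp only: Bcontfun_inverse[OF \<Phi>])
    qed
    fix v v' :: "(real \<times> real) \<Rightarrow>\<^sub>C real"
    have diff: "\<bar>g v s y - g v' s y\<bar> \<le> (M * dist v v') * exp (L * s)" if s: "0 \<le> s" "s \<le> T" for s y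
    proof -
      have "g v s y - g v' s y = q y * (exp (L * s) * (apply_bcontfun v' (s, y) - apply_bcontfun v (s, y)))"
        by (simp add: g_def c_id[OF s] algebra_simps)
      also have "\<bar>\<dots>\<bar> \<le> M * (exp (L * s) * dist v v')"
        unfolding abs_mult using M M0 dist_bounded[of v' "(s, y)" v]
        by (intro mult_mono) (auto simp: dist_real_def dist_commute)
      finally show ?thesis by (simp add: mult_ac)
    qed
    have cont_diff: "continuous_on UNIV (\<lambda>(t, x). g v t x - g v' t x)"
      using continuous_on_diff[OF g[of v] g[of v']] by (simp add: case_prod_unfold)
    show "dist (Bcontfun (\<Phi> v)) (Bcontfun (\<Phi> v')) \<le> 1 / 4 * dist v v'"
    proof (rule dist_bound)
      fix p :: "real \<times> real"
      have "\<Phi> v p - \<Phi> v' p =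
          exp (- L * c (fst p)) * (duhamel (\<lambda>s y. g v s y - g v' s y) (c (fst p)) (snd p) / 2)"
        unfolding duhamel_diff[OF g g] by (simp add: \<Phi>_def case_prod_unfold right_diff_distrib diff_divide_distrib)
      also have "\<bar>\<dots>\<bar> \<le> T * (M * dist v v') / L" by (rule bound[OF cont_diff diff])
      also have "\<dots> = T * M / L * dist v v'" by simp
      also have "\<dots> \<le> 1 / 4 * dist v v'"
        using L by (intro mult_right_mono) (auto simp: L_def field_simps)
      finally show "dist (apply_bcontfun (Bcontfun (\<Phi> v)) p) (apply_bcontfun (Bcontfun (\<Phi> v')) p) \<le> 1 / 4 * dist v v'"
        by (simp add: Bcontfun_inverse[OF \<Phi>] dist_real_def)
    qed
  qed auto
  then obtain v where v: "v \<in> X" "Bcontfun (\<Phi> v) = v" by blast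
  then have fp: "apply_bcontfun v = \<Phi> v" using Bcontfun_inverse[OF \<Phi>] by metis
  define w where "w t x = exp (L * c t) * apply_bcontfun v (t, x)" for t x
  show thesis
  proof (rule that[of w])
    have "continuous_on UNIV (\<lambda>p. exp (L * c (fst p)) * apply_bcontfun v p)"
      by (intro continuous_intros continuous_on_compose2[OF cc] continuous_on_apply_bcontfun) auto
    then show "continuous_on UNIV (\<lambda>(t, x). w t x)" by (simp add: w_def case_prod_unfold)
    show "w t (2 * a - x) = - w t x" if "a \<in> {0, 1}" for t x a
      using v(1) that unfolding X_def w_def by auto
    show "w t x = duhamel (\<lambda>s y. h s y - q y * w s y) (max 0 (min T t)) x / 2" for t x
    proof -
      have "w t x = exp (L * c t) * \<Phi> v (t, x)" by (simp add: w_def fp)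
      also have "\<dots> = (exp (L * c t) * exp (- L * c t)) * (duhamel (g v) (c t) x / 2)"
        by (simp add: \<Phi>_def)
      also have "exp (L * c t) * exp (- L * c t) = 1" by (simp add: exp_add[symmetric])
      finally show ?thesis by (simp add: g_def[abs_def] w_def c_def)
    qed
  qed
qed

lemma higher_deriv_2_reflect_odd:
  assumes s: "smooth_on UNIV f" and odd: "\<And>x. f (b - x) = - f x"
  shows "(deriv ^^ 2) f (b - x) = - (deriv ^^ 2) f x"
proof -
  have "(deriv ^^ 2) (\<lambda>x. f (b + (-1) * x)) = (deriv ^^ 2) (\<lambda>x. 0 + (-1) * f x)"
    using odd by simp
  then have "(-1)\<^sup>2 * (deriv ^^ 2) f (b + (-1) * x) = (deriv ^^ 2) (\<lambda>x. 0) x + (-1) * (deriv ^^ 2) f x"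
    unfolding smooth_on_affine(2)[OF s] smooth_on_add_scaled(2)[OF smooth_on_zero s] by metis
  then show ?thesis unfolding higher_deriv_zero by simp
qed

text \<open>Subtracting \<open>f0 x + t * f1 x\<close> leaves zero initial data and a forcing
  \<open>h\<close> that is again odd about 0 and 1. Continuity of \<open>u\<close> and
  \<open>ut\<close> on the whole plane is recorded separately, because \<open>wave_solution\<close>
  controls \<open>ut\<close> only for \<open>x\<close> in the open interval, which would not bound
  it.\<close>

lemma wave_solution_exists:
  assumes T: "T > 0"
    and smooth: "smooth_on UNIV q" "smooth_on UNIV f0" "smooth_on UNIV f1"
    and bounded: "\<And>k. \<exists>B. \<forall>x. \<bar>(deriv ^^ k) q x\<bar> \<le> B" "\<And>k. \<exists>B. \<forall>x. \<bar>(deriv ^^ k) f0 x\<bar> \<le> B"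
      "\<And>k. \<exists>B. \<forall>x. \<bar>(deriv ^^ k) f1 x\<bar> \<le> B"
    and refl: "\<And>a x. a \<in> {0, 1} \<Longrightarrow> q (2 * a - x) = q x" "\<And>a x. a \<in> {0, 1} \<Longrightarrow> f0 (2 * a - x) = - f0 x"
      "\<And>a x. a \<in> {0, 1} \<Longrightarrow> f1 (2 * a - x) = - f1 x"
  obtains u ut where "wave_solution T q f0 f1 u ut"
    "continuous_on UNIV (\<lambda>(t, x). u t x)" "continuous_on UNIV (\<lambda>(t, x). ut t x)"
proof -
  define Q F G where "Q k = (deriv ^^ k) q" and "F k = (deriv ^^ k) f0" and "G k = (deriv ^^ k) f1" for k
  have d: "(Q k has_real_derivative Q (Suc k) x) (at x)" "(F k has_real_derivative F (Suc k) x) (at x)"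
    "(G k has_real_derivative G (Suc k) x) (at x)" for k x
    unfolding Q_def F_def G_def using smooth by (auto intro: smooth_on_DERIV simp del: funpow.simps)
  have cont: "continuous_on A (Q k)" "continuous_on A (F k)" "continuous_on A (G k)" for A k
    unfolding Q_def F_def G_def using smooth by (auto intro: smooth_on_continuous_higher_deriv)
  have zero: "Q 0 = q" "F 0 = f0" "G 0 = f1" by (simp_all add: Q_def F_def G_def)
  obtain BQ BF BG where B: "\<And>k x. \<bar>Q k x\<bar> \<le> BQ k" "\<And>k x. \<bar>F k x\<bar> \<le> BF k" "\<And>k x. \<bar>G k x\<bar> \<le> BG k"
    using bounded unfolding Q_def F_def G_def by metis
  have contp: "continuous_on A (\<lambda>p. Q k (snd p))" "continuous_on A (\<lambda>p. F k (snd p))"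
    "continuous_on A (\<lambda>p. G k (snd p))" for A :: "(real \<times> real) set" and k
    by (rule continuous_on_compose2[OF cont(1)[of UNIV k]] continuous_on_compose2[OF cont(2)[of UNIV k]]
        continuous_on_compose2[OF cont(3)[of UNIV k]]; auto intro!: continuous_intros)+
  \<comment> \<open>The forcing for \<open>w = u - (f0 + t * f1)\<close>, which has to satisfy w_tt
    - w_xx + q w = h.\<close>
  define h where "h t x = F 2 x + t * G 2 x - Q 0 x * (F 0 x + t * G 0 x)" for t x
  define h' where "h' t x = F 3 x + t * G 3 x - (Q 1 x * (F 0 x + t * G 0 x) + Q 0 x * (F 1 x + t * G 1 x))" for t x
  have ch: "continuous_on UNIV (\<lambda>(t, x). h t x)" and ch': "continuous_on UNIV (\<lambda>(t, x). h' t x)"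
    unfolding h_def h'_def case_prod_unfold by (intro continuous_intros contp)+
  have dh: "(h t has_real_derivative h' t x) (at x)" for t x
    unfolding h_def[abs_def] h'_def
    using d[of 0 x] d[of 1 x] d[of 2 x]
    by (auto intro!: derivative_eq_intros simp: algebra_simps eval_nat_numeral)
  have hb: "\<bar>h t x\<bar> \<le> BF 2 + T * BG 2 + BQ 0 * (BF 0 + T * BG 0)" if t: "0 \<le> t" "t \<le> T" for t x
  proof -
    have 1: "\<bar>t * G k x\<bar> \<le> T * BG k" for k
      unfolding abs_mult using t B(3) by (intro mult_mono) auto
    have 2: "\<bar>F k x + t * G k x\<bar> \<le> BF k + T * BG k" for k
      using abs_triangle_ineq[of "F k x" "t * G k x"] 1[of k] B(2)[of k x] by linarith
    have "\<bar>Q 0 x * (F 0 x + t * G 0 x)\<bar> \<le> BQ 0 * (BF 0 + T * BG 0)"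
      unfolding abs_mult using 2 B(1) order_trans[OF abs_ge_zero B(1)] by (intro mult_mono) auto
    then show ?thesis
      using abs_triangle_ineq4[of "F 2 x + t * G 2 x" "Q 0 x * (F 0 x + t * G 0 x)"] 2[of 2]
      unfolding h_def by linarith
  qed
  have h_odd: "h t (2 * a - x) = - h t x" if a: "a \<in> {0, 1}" for t x a
  proof -
    have "F 2 (2 * a - x) = - F 2 x" "G 2 (2 * a - x) = - G 2 x"
      unfolding F_def G_def using smooth refl(2,3)[OF a] by (auto intro!: higher_deriv_2_reflect_odd)
    then show ?thesis unfolding h_def zero using refl(1,2,3)[OF a] by (simp add: algebra_simps)
  qed
  obtain w where w: "continuous_on UNIV (\<lambda>(t, x). w t x)"
    "\<And>t x. w t x = duhamel (\<lambda>s y. h s y - q y * w s y) (max 0 (min T t)) x / 2"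
    "\<And>t x a. a \<in> {0, 1} \<Longrightarrow> w t (2 * a - x) = - w t x"
    by (rule duhamel_fixed_point[OF T ch cont(1)[of UNIV 0, unfolded zero] hb B(1)[of 0, unfolded zero]
        h_odd refl(1)]) blast+
  define g where "g s y = h s y - Q 0 y * w s y" for s y
  have cg: "continuous_on UNIV (\<lambda>(t, x). g t x)"
    unfolding g_def case_prod_unfold
    by (intro continuous_intros contp continuous_on_compose_pair[OF ch] continuous_on_compose_pair[OF w(1)])
  \<comment> \<open>Bootstrap: \<open>w\<close> and hence \<open>g\<close> are continuous, so the
    fixed point equation makes \<open>w\<close> continuously differentiable in \<open>x\<close>.
    Then \<open>g\<close> has the continuous derivative \<open>gx\<close>, and the transports of
    \<open>g\<close> can be differentiated once more.\<close>
  define wx where "wx t x = (transport 1 g (max 0 (min T t)) x - transport (-1) g (max 0 (min T t)) x) / 2" for t x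
  have w_eq: "w t = (\<lambda>x. duhamel g (max 0 (min T t)) x / 2)" for t
    unfolding g_def[abs_def] zero using w(2) by blast
  have dw: "(w t has_real_derivative wx t x) (at x)" for t x
    unfolding w_eq wx_def by (intro DERIV_cdivide duhamel_deriv_x cg)
  have cwx: "continuous_on UNIV (\<lambda>(t, x). wx t x)"
    unfolding wx_def case_prod_unfold
    by (intro continuous_intros continuous_on_compose_pair[OF continuous_on_transport[OF cg]]) simp
  define gx where "gx s y = h' s y - (Q 1 y * w s y + Q 0 y * wx s y)" for s y
  have cgx: "continuous_on UNIV (\<lambda>(t, x). gx t x)"
    unfolding gx_def case_prod_unfold
    by (intro continuous_intros contp continuous_on_compose_pair[OF ch'] continuous_on_compose_pair[OF w(1)]
        continuous_on_compose_pair[OF cwx])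
  have dg: "(g t has_real_derivative gx t x) (at x)" for t x
    unfolding g_def[abs_def] gx_def
    using d(1)[of 0 x] by (auto intro!: derivative_eq_intros dh dw)
  have ctr: "continuous_on A (\<lambda>p. transport c g (fst p) (snd p))"
    "continuous_on A (\<lambda>p. transport c gx (fst p) (snd p))" for A c
    by (intro continuous_on_compose_pair[OF continuous_on_transport[OF cg]]
        continuous_on_compose_pair[OF continuous_on_transport[OF cgx]] continuous_intros)+
  have cg': "continuous_on A (\<lambda>p. g (fst p) (snd p))" for A
    by (intro continuous_on_compose_pair[OF cg] continuous_intros)
  \<comment> \<open>Without clamping in the outer time argument, \<open>u\<close> has two-sided time
    derivatives also at 0 and \<open>T\<close>. It agrees with \<open>w + f0 + t * f1\<close>, and
    hence solves the equation, for \<open>t\<close> in [0,T].\<close>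
  define u where "u t x = duhamel g t x / 2 + (F 0 x + t * G 0 x)" for t x
  define ut where "ut t x = (transport 1 g t x + transport (-1) g t x) / 2 + G 0 x" for t x
  define utt where "utt t x = ((g t x + 1 * transport 1 gx t x) + (g t x + (-1) * transport (-1) gx t x)) / 2" for t x
  define ux where "ux t x = (transport 1 g t x - transport (-1) g t x) / 2 + (F 1 x + t * G 1 x)" for t x
  define uxx where "uxx t x = (transport 1 gx t x - transport (-1) gx t x) / 2 + (F 2 x + t * G 2 x)" for t x
  have cu: "continuous_on A (\<lambda>(t, x). u t x)" for A
    unfolding u_def case_prod_unfold
    by (intro continuous_intros contp continuous_on_compose_pair[OF continuous_on_duhamel[OF cg]]) simp
  have cut: "continuous_on A (\<lambda>(t, x). ut t x)" for A
    unfolding ut_def case_prod_unfold by (intro continuous_intros contp ctr) simp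
  have cutt: "continuous_on A (\<lambda>(t, x). utt t x)" for A
    unfolding utt_def case_prod_unfold by (intro continuous_intros contp ctr cg') simp
  have cux: "continuous_on A (\<lambda>(t, x). ux t x)" for A
    unfolding ux_def case_prod_unfold by (intro continuous_intros contp ctr) simp
  have cuxx: "continuous_on A (\<lambda>(t, x). uxx t x)" for A
    unfolding uxx_def case_prod_unfold by (intro continuous_intros contp ctr) simp
  have dut: "((\<lambda>s. u s x) has_real_derivative ut t x) (at t)" for t x
    unfolding u_def ut_def
    by (intro DERIV_add DERIV_cdivide duhamel_deriv_t cg) (auto intro!: derivative_eq_intros)
  have dutt: "((\<lambda>s. ut s x) has_real_derivative utt t x) (at t)" for t x
  proof -
    have "((\<lambda>s. (transport 1 g s x + transport (-1) g s x) / 2 + G 0 x) has_real_derivative utt t x + 0) (at t)"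
      unfolding utt_def by (intro DERIV_add DERIV_cdivide transport_deriv_t cg cgx dg DERIV_const)
    then show ?thesis by (simp add: ut_def)
  qed
  have dux: "(u t has_real_derivative ux t x) (at x)" for t x
    unfolding u_def[abs_def] ux_def
    using d(2,3)[of 0 x] by (intro DERIV_add DERIV_cdivide DERIV_cmult duhamel_deriv_x cg) simp_all
  have duxx: "(ux t has_real_derivative uxx t x) (at x)" for t x
    unfolding ux_def[abs_def] uxx_def
    using d(2,3)[of 1 x]
    by (intro DERIV_add DERIV_cdivide DERIV_cmult DERIV_diff transport_deriv_x cg cgx dg)
      (simp_all add: eval_nat_numeral)
  have uw: "u t x = w t x + (f0 x + t * f1 x)" if "t \<in> {0..T}" for t x
    using that by (simp add: u_def w_eq zero)
  have pde: "utt t x - uxx t x + q x * u t x = 0" if "t \<in> {0..T}" for t x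
    unfolding uw[OF that] by (simp add: utt_def uxx_def g_def h_def zero field_simps)
  have init: "u 0 x = f0 x" "ut 0 x = f1 x" for x
    by (simp_all add: u_def ut_def zero duhamel_def transport_def)
  \<comment> \<open>The point \<open>a\<close> is fixed by the reflection about \<open>a\<close>, so
    a function odd about \<open>a\<close> vanishes there.\<close>
  have bdry: "u t 0 = 0" "u t 1 = 0" if t: "t \<in> {0..T}" for t
  proof -
    have "w t a = 0" "f0 a = 0" "f1 a = 0" if "a \<in> {0, 1}" for a
      using w(3)[OF that, of t a] refl(2,3)[OF that, of a] by simp_all
    from this[of 0] this[of 1] show "u t 0 = 0" "u t 1 = 0" by (simp_all add: uw[OF t])
  qed
  have "wave_solution T q f0 f1 u ut"
    unfolding wave_solution_def
    by (intro conjI exI[of _ utt] exI[of _ ux] exI[of _ uxx] ballI has_field_derivative_at_within[OF dut]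
        has_field_derivative_at_within[OF dutt] cu cut cutt cux cuxx dux duxx pde init bdry) auto
  with cu cut show thesis by (intro that)
qed

section \<open>Very weak solutions\<close>

text \<open>Differentiation exchanges the two forms \<open>P (cos (pi * x))\<close> and
  \<open>sin (pi * x) * P (cos (pi * x))\<close>, so together they form a class closed under it. All
  derivatives are then bounded because polynomials are bounded on [-1,1].\<close>

lemma trig_polynomial_smooth:
  assumes P: "real_polynomial_function P"
    and f: "f = (\<lambda>x. P (cos (pi * x))) \<or> f = (\<lambda>x. sin (pi * x) * P (cos (pi * x)))"
  shows "smooth_on UNIV f" and "\<exists>B. \<forall>x. \<bar>(deriv ^^ k) f x\<bar> \<le> B"
proof -
  define X where "X = {f. \<exists>P. real_polynomial_function P \<and>
    (f = (\<lambda>x. P (cos (pi * x))) \<or> f = (\<lambda>x. sin (pi * x) * P (cos (pi * x))))}"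
  have fX: "f \<in> X" using P f by (auto simp: X_def)
  have step: "\<exists>g'\<in>X. \<forall>x. (g has_real_derivative g' x) (at x)" if "g \<in> X" for g
  proof -
    obtain P where P: "real_polynomial_function P"
      and g: "g = (\<lambda>x. P (cos (pi * x))) \<or> g = (\<lambda>x. sin (pi * x) * P (cos (pi * x)))"
      using \<open>g \<in> X\<close> by (auto simp: X_def)
    obtain P' where P': "real_polynomial_function P'" "\<And>x. (P has_real_derivative P' x) (at x)"
      using has_real_derivative_polynomial_function[OF P] by blast
    have d: "((\<lambda>x. P (cos (pi * x))) has_real_derivative P' (cos (pi * x)) * (- sin (pi * x) * pi)) (at x)" for x
      by (rule DERIV_chain2[OF P'(2)]) (auto intro!: derivative_eq_intros)
    from g show ?thesis
    proof
      assume g: "g = (\<lambda>x. P (cos (pi * x)))"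
      have "real_polynomial_function (\<lambda>c. - pi * P' c)"
        by (intro real_polynomial_function.intros(2,4) P'(1))
      then have "(\<lambda>x. sin (pi * x) * (- pi * P' (cos (pi * x)))) \<in> X" by (auto simp: X_def)
      moreover have "(g has_real_derivative sin (pi * x) * (- pi * P' (cos (pi * x)))) (at x)" for x
        using d[of x] by (simp add: g mult_ac)
      ultimately show ?thesis by (intro bexI[of _ "\<lambda>x. sin (pi * x) * (- pi * P' (cos (pi * x)))"]) auto
    next
      assume g: "g = (\<lambda>x. sin (pi * x) * P (cos (pi * x)))"
      \<comment> \<open>The product rule produces a squared sine; writing it as
        \<open>1 - c\<^sup>2\<close> with \<open>c = cos (pi * x)\<close> returns a polynomial in
        the cosine.\<close>
      define R where "R c = pi * (c * P c) - pi * ((1 - c\<^sup>2) * P' c)" for c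
      have "real_polynomial_function R"
        unfolding R_def
        by (intro real_polynomial_function.intros(2,4) real_polynomial_function_diff P'(1) P
            real_polynomial_function_power real_polynomial_function.intros(1) bounded_linear_ident)
      then have "(\<lambda>x. R (cos (pi * x))) \<in> X" by (auto simp: X_def)
      moreover have "(g has_real_derivative R (cos (pi * x))) (at x)" for x
      proof -
        have s: "((\<lambda>x. sin (pi * x)) has_real_derivative cos (pi * x) * pi) (at x)"
          by (auto intro!: derivative_eq_intros)
        have "1 - (cos (pi * x))\<^sup>2 = sin (pi * x) * sin (pi * x)"
          using sin_cos_squared_add[of "pi * x"] by (simp add: power2_eq_square)
        then have R: "R (cos (pi * x)) = pi * (cos (pi * x) * P (cos (pi * x))) -
            pi * (sin (pi * x) * sin (pi * x) * P' (cos (pi * x)))"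
          by (simp only: R_def)
        show ?thesis
          unfolding g R by (rule DERIV_cong[OF DERIV_mult[OF s d]]) (simp add: algebra_simps)
      qed
      ultimately show ?thesis by (intro bexI[of _ "\<lambda>x. R (cos (pi * x))"]) auto
    qed
  qed
  show "smooth_on UNIV f" using fX step by (rule smooth_on_UNIV_coinduct(1))
  have "(deriv ^^ k) f \<in> X" using fX step by (rule smooth_on_UNIV_coinduct(2))
  then obtain P where P: "real_polynomial_function P"
    and g: "(deriv ^^ k) f = (\<lambda>x. P (cos (pi * x))) \<or> (deriv ^^ k) f = (\<lambda>x. sin (pi * x) * P (cos (pi * x)))"
    by (auto simp: X_def)
  have "bounded (P ` {-1..1})"
    using P by (intro compact_imp_bounded compact_continuous_image continuous_on_polymonial_function)
      (auto simp: real_polynomial_function_eq)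
  then obtain B where B: "\<forall>y\<in>{-1..1}. \<bar>P y\<bar> \<le> B" by (auto simp: bounded_iff)
  have 1: "\<bar>P (cos (pi * x))\<bar> \<le> B" for x using B by simp
  have "\<bar>sin (pi * x) * P (cos (pi * x))\<bar> \<le> 1 * B" for x
    unfolding abs_mult using 1 by (intro mult_mono abs_sin_le_one) auto
  with 1 g show "\<exists>B. \<forall>x. \<bar>(deriv ^^ k) f x\<bar> \<le> B" by (intro exI[of _ B]) auto
qed

text \<open>At each \<epsilon> the largest index whose bound is affordable is taken. The condition
  \<open>n \<le> 1 / \<epsilon>\<close> makes the candidates finite, \<open>C \<ge> B 0\<close> and
  \<open>C > 0\<close> make 0 a candidate for every \<epsilon>, and each fixed index becomes
  affordable as \<epsilon> tends to 0.\<close>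

lemma slow_reparametrisation:
  fixes B :: "nat \<Rightarrow> real"
  obtains \<nu> C where "C > 0" "\<And>\<epsilon>. \<epsilon> \<in> {0<..1} \<Longrightarrow> B (\<nu> \<epsilon>) \<le> C / \<epsilon>" "filterlim \<nu> sequentially (at_right 0)"
proof -
  define C where "C = max 1 (B 0)"
  define S where "S \<epsilon> = {n. real n \<le> 1 / \<epsilon> \<and> B n \<le> C / \<epsilon>}" for \<epsilon>
  have C: "C \<ge> 1" "C \<ge> B 0" by (auto simp: C_def)
  have fin: "finite (S \<epsilon>)" for \<epsilon>
  proof (rule finite_subset)
    show "S \<epsilon> \<subseteq> {..nat \<lfloor>1 / \<epsilon>\<rfloor>}" by (auto simp: S_def le_nat_floor)
  qed simp
  have "0 \<in> S \<epsilon>" if "\<epsilon> \<in> {0<..1}" for \<epsilon>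
  proof -
    have "C \<le> C / \<epsilon>" using that C mult_left_le[of \<epsilon> C] by (simp add: field_simps)
    then show ?thesis using that C by (simp add: S_def)
  qed
  then have mem: "Max (S \<epsilon>) \<in> S \<epsilon>" if "\<epsilon> \<in> {0<..1}" for \<epsilon>
    using that fin by (intro Max_in) auto
  show thesis
  proof (rule that[of C "\<lambda>\<epsilon>. Max (S \<epsilon>)"])
    show "C > 0" using C by simp
    show "B (Max (S \<epsilon>)) \<le> C / \<epsilon>" if "\<epsilon> \<in> {0<..1}" for \<epsilon> using mem[OF that] by (simp add: S_def)
    show "filterlim (\<lambda>\<epsilon>. Max (S \<epsilon>)) sequentially (at_right 0)"
      unfolding filterlim_at_top
    proof
      fix Z :: nat
      \<comment> \<open>One entry for each condition in \<open>S\<close>; \<open>max 1\<close>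
        guards against a nonpositive \<open>B Z\<close>, and \<open>real Z + 1\<close> against
        \<open>Z = 0\<close>.\<close>
      define \<delta> where "\<delta> = min (1 / (real Z + 1)) (C / max 1 (B Z))"
      have \<delta>: "\<delta> > 0" using C by (simp add: \<delta>_def)
      show "\<forall>\<^sub>F \<epsilon> in at_right 0. Z \<le> Max (S \<epsilon>)"
      proof (rule eventually_at_rightI[OF _ \<delta>])
        fix \<epsilon> assume \<epsilon>: "\<epsilon> \<in> {0<..<\<delta>}"
        then have "\<epsilon> * (real Z + 1) < 1" "\<epsilon> * max 1 (B Z) < C" by (simp_all add: \<delta>_def field_simps)
        moreover have "\<epsilon> * real Z \<le> \<epsilon> * (real Z + 1)" "\<epsilon> * B Z \<le> \<epsilon> * max 1 (B Z)"
          using \<epsilon> by (auto intro: mult_left_mono)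
        ultimately have "\<epsilon> * real Z \<le> 1" "\<epsilon> * B Z \<le> C" by linarith+
        then have "Z \<in> S \<epsilon>" using \<epsilon> by (simp add: S_def field_simps)
        then show "Z \<le> Max (S \<epsilon>)" using fin by (rule Max_ge[rotated])
      qed
    qed
  qed
qed

lemma L2_norm_le_bound:
  fixes v :: "real \<Rightarrow> real"
  assumes v: "continuous_on {0..1} v" and B: "\<And>x. x \<in> {0..1} \<Longrightarrow> \<bar>v x\<bar> \<le> B"
  shows "(\<lambda>x. (v x)\<^sup>2) integrable_on {0..1}" "sqrt (integral {0..1} (\<lambda>x. (v x)\<^sup>2)) \<le> B"
proof -
  show i: "(\<lambda>x. (v x)\<^sup>2) integrable_on {0..1}"
    by (intro integrable_continuous_interval continuous_intros v)
  have B0: "B \<ge> 0" using B[of 0] by simp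
  have "integral {0..1} (\<lambda>x. (v x)\<^sup>2) \<le> integral {0..1} (\<lambda>x::real. B\<^sup>2)"
    by (rule integral_le[OF i integrable_continuous_interval[OF continuous_on_const]]) (use B B0 in \<open>simp_all add: power2_le_iff_abs_le\<close>)
  then have "integral {0..1} (\<lambda>x. (v x)\<^sup>2) \<le> B\<^sup>2" by simp
  with B0 show "sqrt (integral {0..1} (\<lambda>x. (v x)\<^sup>2)) \<le> B" by (intro real_le_lsqrt) auto
qed

lemma continuous_bounded_on_compact:
  fixes f :: "'a::metric_space \<Rightarrow> real"
  assumes "continuous_on UNIV f" "compact S"
  shows "\<exists>B. \<forall>p\<in>S. \<bar>f p\<bar> \<le> B"
proof -
  have "bounded (f ` S)"
    using assms continuous_on_subset by (blast intro: compact_imp_bounded compact_continuous_image)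
  then show ?thesis by (auto simp: bounded_iff)
qed

lemma regularisation_reparametrised:
  assumes "\<And>n. smooth_on UNIV (v n)"
    and "\<And>\<phi>. test_fun \<phi> \<Longrightarrow> (\<lambda>n. integral {0..1} (\<lambda>x. v n x * \<phi> x)) \<longlonglongrightarrow> D \<phi>"
    and "filterlim \<nu> sequentially (at_right 0)"
  shows "regularisation (\<lambda>\<epsilon>. v (\<nu> \<epsilon>)) D"
  unfolding regularisation_def
  using assms(1) filterlim_compose[OF assms(2,3)] smooth_on_subset by blast

theorem theorem3:
  fixes q u0 u1 :: "(real \<Rightarrow> real) \<Rightarrow> real" and T :: real
  assumes "distribution01 q" and "distribution01 u0" and "distribution01 u1" and "T > 0"
  shows "\<exists>u. very_weak_solution T q u0 u1 u"
proof -
  obtain P where P: "\<And>n::nat. real_polynomial_function (P n)"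
    and q_lim: "\<And>\<phi>. test_fun \<phi> \<Longrightarrow> (\<lambda>n. integral {0..1} (\<lambda>x. P n (cos (pi * x)) * \<phi> x)) \<longlonglongrightarrow> q \<phi>"
    by (rule distribution01_approx_cos[OF assms(1)]) blast
  obtain P0 where P0: "\<And>n::nat. real_polynomial_function (P0 n)"
    and u0_lim: "\<And>\<phi>. test_fun \<phi> \<Longrightarrow>
      (\<lambda>n. integral {0..1} (\<lambda>x. sin (pi * x) * P0 n (cos (pi * x)) * \<phi> x)) \<longlonglongrightarrow> u0 \<phi>"
    by (rule distribution01_approx_sin[OF assms(2)]) blast
  obtain P1 where P1: "\<And>n::nat. real_polynomial_function (P1 n)"
    and u1_lim: "\<And>\<phi>. test_fun \<phi> \<Longrightarrow>
      (\<lambda>n. integral {0..1} (\<lambda>x. sin (pi * x) * P1 n (cos (pi * x)) * \<phi> x)) \<longlonglongrightarrow> u1 \<phi>"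
    by (rule distribution01_approx_sin[OF assms(3)]) blast
  define Q where "Q n x = P n (cos (pi * x))" for n x
  define F0 where "F0 n x = sin (pi * x) * P0 n (cos (pi * x))" for n x
  define F1 where "F1 n x = sin (pi * x) * P1 n (cos (pi * x))" for n x
  have Q: "smooth_on UNIV (Q n)" "\<exists>B. \<forall>x. \<bar>(deriv ^^ k) (Q n) x\<bar> \<le> B" for n k
    by (rule trig_polynomial_smooth[OF P[of n]]; simp add: Q_def[abs_def])+
  have F0: "smooth_on UNIV (F0 n)" "\<exists>B. \<forall>x. \<bar>(deriv ^^ k) (F0 n) x\<bar> \<le> B" for n k
    by (rule trig_polynomial_smooth[OF P0[of n]]; simp add: F0_def[abs_def])+
  have F1: "smooth_on UNIV (F1 n)" "\<exists>B. \<forall>x. \<bar>(deriv ^^ k) (F1 n) x\<bar> \<le> B" for n k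
    by (rule trig_polynomial_smooth[OF P1[of n]]; simp add: F1_def[abs_def])+
  have trig_refl: "cos (pi * (2 * a - x)) = cos (pi * x)" "sin (pi * (2 * a - x)) = - sin (pi * x)"
    if "a \<in> {0, 1}" for a x :: real
    using that by (auto simp: right_diff_distrib cos_diff sin_diff mult.commute[of pi 2])
  have "\<exists>u ut. wave_solution T (Q n) (F0 n) (F1 n) u ut \<and>
    continuous_on UNIV (\<lambda>(t, x). u t x) \<and> continuous_on UNIV (\<lambda>(t, x). ut t x)" for n
    by (rule wave_solution_exists[OF assms(4) Q(1) F0(1) F1(1) Q(2) F0(2) F1(2)])
      (auto simp: Q_def F0_def F1_def trig_refl)
  then obtain U Ut where U: "\<And>n. wave_solution T (Q n) (F0 n) (F1 n) (U n) (Ut n)"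
    and cU: "\<And>n. continuous_on UNIV (\<lambda>(t, x). U n t x)" and cUt: "\<And>n. continuous_on UNIV (\<lambda>(t, x). Ut n t x)"
    by metis
  have "compact ({0..T} \<times> {0..1::real})" by (intro compact_Times compact_Icc)
  then obtain BU BUt where BU: "\<And>n. \<forall>p\<in>{0..T} \<times> {0..1}. \<bar>case_prod (U n) p\<bar> \<le> BU n"
    and BUt: "\<And>n. \<forall>p\<in>{0..T} \<times> {0..1}. \<bar>case_prod (Ut n) p\<bar> \<le> BUt n"
    using continuous_bounded_on_compact[OF cU] continuous_bounded_on_compact[OF cUt] by metis
  obtain BQ BF0 BF1 where BQ: "\<And>n x. \<bar>Q n x\<bar> \<le> BQ n" and BF0: "\<And>n x. \<bar>F0 n x\<bar> \<le> BF0 n"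
    and BF1: "\<And>n x. \<bar>F1 n x\<bar> \<le> BF1 n"
    using Q(2)[of 0] F0(2)[of 0] F1(2)[of 0] by (simp only: funpow_0) metis
  \<comment> \<open>Potential, data, solution and time derivative share one index, so a single
    majorant has to be slowed down. Each of the five nets is then moderate with the same
    \<open>C\<close> and exponent 1.\<close>
  define B where "B n = max (BQ n) (max (BF0 n) (max (BF1 n) (max (BU n) (BUt n))))" for n
  obtain \<nu> C where C: "C > 0" and bound: "\<And>\<epsilon>. \<epsilon> \<in> {0<..1} \<Longrightarrow> B (\<nu> \<epsilon>) \<le> C / \<epsilon>"
    and \<nu>: "filterlim \<nu> sequentially (at_right 0)"
    by (rule slow_reparametrisation[of B]) blast
  have powr: "C / \<epsilon> = C * \<epsilon> powr - real 1" if "\<epsilon> \<in> {0<..1}" for \<epsilon>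
    using that by (simp add: powr_minus divide_inverse)
  have cont: "continuous_on {0..1} f" if "smooth_on UNIV f" for f
    using smooth_on_continuous_higher_deriv[OF that, of _ 0] by simp
  have moderate: "(\<lambda>x. (v x)\<^sup>2) integrable_on {0..1} \<and>
      sqrt (integral {0..1} (\<lambda>x. (v x)\<^sup>2)) \<le> C * \<epsilon> powr - real 1"
    if "\<epsilon> \<in> {0<..1}" "continuous_on {0..1} v" "\<And>x. x \<in> {0..1} \<Longrightarrow> \<bar>v x\<bar> \<le> B (\<nu> \<epsilon>)"
    for v :: "real \<Rightarrow> real" and \<epsilon>
    using L2_norm_le_bound[OF that(2,3)] bound[OF that(1)] powr[OF that(1)] by simp
  have "very_weak_solution T q u0 u1 (\<lambda>\<epsilon>. U (\<nu> \<epsilon>))"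
    unfolding very_weak_solution_def
  proof (intro exI conjI ballI)
    show "regularisation (\<lambda>\<epsilon>. Q (\<nu> \<epsilon>)) q"
      using Q(1) q_lim \<nu> unfolding Q_def[abs_def] by (rule regularisation_reparametrised)
    show "regularisation (\<lambda>\<epsilon>. F0 (\<nu> \<epsilon>)) u0"
      using F0(1) u0_lim \<nu> unfolding F0_def[abs_def] by (rule regularisation_reparametrised)
    show "regularisation (\<lambda>\<epsilon>. F1 (\<nu> \<epsilon>)) u1"
      using F1(1) u1_lim \<nu> unfolding F1_def[abs_def] by (rule regularisation_reparametrised)
    show "wave_solution T (Q (\<nu> \<epsilon>)) (F0 (\<nu> \<epsilon>)) (F1 (\<nu> \<epsilon>)) (U (\<nu> \<epsilon>)) (Ut (\<nu> \<epsilon>))" for \<epsilon>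
      by (rule U)
    have "\<bar>Q (\<nu> \<epsilon>) x\<bar> \<le> C * \<epsilon> powr - real 1" if "\<epsilon> \<in> {0<..1}" for \<epsilon> x
      using BQ[of "\<nu> \<epsilon>" x] bound[OF that] powr[OF that] unfolding B_def by linarith
    then show "Linf_moderate (\<lambda>\<epsilon>. Q (\<nu> \<epsilon>))"
      unfolding Linf_moderate_def using C by blast
    have "\<bar>F0 n x\<bar> \<le> B n" "\<bar>F1 n x\<bar> \<le> B n" for n x
      using BF0[of n x] BF1[of n x] unfolding B_def by linarith+
    then show "L2_moderate (\<lambda>\<epsilon>. F0 (\<nu> \<epsilon>))" "L2_moderate (\<lambda>\<epsilon>. F1 (\<nu> \<epsilon>))"
      unfolding L2_moderate_def using C moderate cont[OF F0(1)] cont[OF F1(1)] by blast+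
    have UB: "\<bar>U n t x\<bar> \<le> B n" "\<bar>Ut n t x\<bar> \<le> B n" if "t \<in> {0..T}" "x \<in> {0..1}" for n t x
    proof -
      have "\<bar>U n t x\<bar> \<le> BU n" "\<bar>Ut n t x\<bar> \<le> BUt n" using BU[of n] BUt[of n] that by auto
      then show "\<bar>U n t x\<bar> \<le> B n" "\<bar>Ut n t x\<bar> \<le> B n" unfolding B_def by linarith+
    qed
    have Uc: "continuous_on {0..1} (U n t)" "continuous_on {0..1} (Ut n t)" for n t
      using continuous_on_section[OF cU] continuous_on_section[OF cUt] continuous_on_subset by blast+
    show "L2_moderate_t T (\<lambda>\<epsilon>. U (\<nu> \<epsilon>))" "L2_moderate_t T (\<lambda>\<epsilon>. Ut (\<nu> \<epsilon>))"
      unfolding L2_moderate_t_def using C moderate[OF _ Uc(1) UB(1)] moderate[OF _ Uc(2) UB(2)] by blast+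
  qed
  then show ?thesis by blast
qed

end
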